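(* Let $\alpha\in\,]0,1[$, let $\bar w\sim\mathcal{N}(0,\bar\Sigma)$ with $\bar\Sigma>0$, and let $$\eta(\bar x_\theta,\bar u_\theta)=\left(\begin{bmatrix}\bar x_\theta\\ \bar u_\theta\end{bmatrix}-\delta\right)^T\Xi\left(\begin{bmatrix}\bar x_\theta\\ \bar u_\theta\end{bmatrix}-\delta\right)-1,$$ where $\Xi\ge 0$ is a given symmetric positive semidefinite matrix of size $(N+1)n+Nm$ and $\delta\in\mathbb{R}^{(N+1)n+Nm}$. Let $\beta(\alpha)=\sqrt{F^{-1}(1-\alpha)}$, where $F$ is the probability distribution function of a $\chi^2$ random variable with $Nn$ degrees of freedom. Define $S_\theta=\beta(\alpha)\,\Xi^{1/2}P'_\theta\bar\Sigma^{1/2}$ and $\xi_\theta=\Xi^{1/2}h'_\theta$. Then $$\begin{bmatrix}-\lambda+1&0&\xi_\theta^T\\0&\lambda I&S_\theta^T\\ \xi_\theta&S_\theta&I\end{bmatrix}\ge 0,\qquad\lambda>0, \qquad( * )$$ is a Linear Matrix Inequality in the unknown parameters $\theta\in\Theta$ and $\lambda\in\mathbb{R}$. If $(\theta,\lambda)$ is a solution of $( * )$, then $\theta$ satisfies $\mathbb{P}(\eta(\bar x_\theta,\bar u_\theta)\le 0)\ge 1-\alpha$. As a consequence, if $V:\mathbb{R}^{(N+1)n}\times\mathbb{R}^{Nm}\to\mathbb{R}$ is measurable and convex and $\mathbb{E}[V(\bar x_\theta,\bar u_\theta)]$ is finite for all $\theta\in\Theta$, then the problem $$\inf_{\theta\in\Theta,\,\lambda}\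 \mathbb{E}[V(\bar x_\theta,\bar u_\theta)]\quad\text{subject to }( * )$$ is a convex conservative approximation of the problem $$\inf_{\theta\in\Theta}\ \mathbb{E}[V(\bar x_\theta,\bar u_\theta)]\quad\text{subject to}\quad\mathbb{P}(\eta(\bar x_\theta,\bar u_\theta)\le 0)\ge 1-\alpha.$$
   Context: Let $n,m,N\ge 1$ be integers, $A\in\mathbb{R}^{n\times n}$, $B\in\mathbb{R}^{n\times m}$, $x_0\in\mathbb{R}^n$, and let $w(0),\dots,w(N-1)$ be $\mathbb{R}^n$-valued random vectors on a probability space $(\Omega,\mathfrak{F},\mathbb{P})$, stacked into $\bar w\in\mathbb{R}^{Nn}$. The linear system $x(t+1)=Ax(t)+Bu(t)+w(t)$, $x(0)=x_0$, is written over $t=0,\dots,N$ as $\bar x=\bar A x_0+\bar B\bar u+\bar D\bar w$, where $\bar x\in\mathbb{R}^{(N+1)n}$ stacks $x(0),\dots,x(N)$ and $\bar u\in\mathbb{R}^{Nm}$ stacks $u(0),\dots,u(N-1)$; $\bar A$ stacks $I_n,A,\dots,A^N$; $\bar B$ is the $(N+1)n\times Nm$ matrix whose $n\times m$ block in position $(t,s)$, $0\le t\le N$, $0\le s\le N-1$, is $A^{t-1-s}B$ if $s<t$ and $0$ otherwise; $\bar D$ is the $(N+1)n\times Nn$ matrix whose $n\times n$ block $(t,s)$ is $A^{t-1-s}$ if $s<t$ and $0$ otherwise. $\Theta$ is the linear space of parameters $\theta=(\bar G,\bar d)$ with $\bar d\in\mathbb{R}^{Nm}$ and $\bar G\in\mathbb{R}^{Nm\times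 Nn}$ strictly block lower triangular (its $m\times n$ block $(t,i)$, $0\le t,i\le N-1$, vanishes whenever $i\ge t$). For $\theta\in\Theta$, $\bar u_\theta=\bar G\bar w+\bar d$ and $\bar x_\theta=\bar A x_0+\bar B(\bar G\bar w+\bar d)+\bar D\bar w$. Set $h'_\theta=\begin{bmatrix}\bar A x_0+\bar B\bar d\\ \bar d\end{bmatrix}-\delta$ and $P'_\theta=\begin{bmatrix}\bar B\bar G+\bar D\\ \bar G\end{bmatrix}$, so that $\begin{bmatrix}\bar x_\theta\\ \bar u_\theta\end{bmatrix}-\delta=h'_\theta+P'_\theta\bar w$. $\Xi^{1/2}$ and $\bar\Sigma^{1/2}$ are the symmetric positive semidefinite square roots. In $( * )$ the identity blocks have sizes $Nn$ (in $\lambda I$) and $(N+1)n+Nm$; $\ge 0$ for matrices means positive semidefinite. A Linear Matrix Inequality in given unknowns is a semidefiniteness constraint on a symmetric matrix depending affinely on the unknowns (together here with the linear inequality $\lambda>0$). The problem with constraint $( * )$ is a convex conservative approximation of the original problem if its objective is convex, its feasible set in $(\theta,\lambda)$ is convex, and for every feasible $(\theta,\lambda)$ the parameter $\theta$ is feasible for the original problem. *)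

theory Defs
  imports "HOL-Probability.Probability"
begin

text \<open>
  Dimensions are index types: the state and input dimensions are the cardinalities of
  \<open>'n\<close> and \<open>'m\<close>. The horizon is the cardinality of a finite linear order
  \<open>'T\<close>, whose element of rank \<open>t\<close> (counted from 0) stands for time \<open>t\<close>. The times
  \<open>0, ..., N\<close> of the state trajectory are indexed by \<open>'T option\<close>: \<open>None\<close> is time 0 and
  \<open>Some s\<close> is the time following \<open>s\<close>. Stacked vectors are indexed by
  pairs (time, component), and a sum type indexes the stacking of two blocks.
\<close>

definition time :: "'T::{finite,linorder} \<Rightarrow> nat" where
  "time t = card {s. s < t}"

fun xtime :: "'T::{finite,linorder} option \<Rightarrow> nat" where
  "xtime None = 0"
| "xtime (Some s) = Suc (time s)"

lemma bij_betw_time: "bij_betw time (UNIV :: 'T::{finite,linorder} set) {..<CARD('T)}"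
proof -
  have mono: "time s < time t" if "s < t" for s t :: 'T
    unfolding time_def by (rule psubset_card_mono, simp) (use that in force)
  have inj: "inj (time :: 'T \<Rightarrow> nat)"
    by (rule injI) (metis mono less_irrefl neqE)
  have "time ` (UNIV :: 'T set) \<subseteq> {..<CARD('T)}"
  proof (rule image_subsetI)
    fix t :: 'T
    have "{s. s < t} \<subset> UNIV" by auto
    then show "time t \<in> {..<CARD('T)}"
      by (simp add: time_def psubset_card_mono)
  qed
  moreover have "card (time ` (UNIV :: 'T set)) = CARD('T)"
    using inj by (rule card_image)
  ultimately have "time ` (UNIV :: 'T set) = {..<CARD('T)}"
    by (intro card_subset_eq) auto
  with inj show ?thesis by (simp add: bij_betw_def)
qed

lemma bij_betw_xtime: "bij_betw xtime (UNIV :: 'T::{finite,linorder} option set) {..CARD('T)}"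
proof -
  have inj: "inj (xtime :: 'T option \<Rightarrow> nat)"
  proof (rule injI)
    fix a b :: "'T option" assume "xtime a = xtime b"
    then show "a = b"
      using bij_betw_time[where 'T='T] by (cases a; cases b) (auto simp: bij_betw_def inj_def)
  qed
  have "xtime a \<le> CARD('T)" for a :: "'T option"
    using bij_betw_time[where 'T='T] by (cases a) (auto simp: bij_betw_def Suc_le_eq)
  then have "xtime ` (UNIV :: 'T option set) \<subseteq> {..CARD('T)}" by auto
  moreover have "card (xtime ` (UNIV :: 'T option set)) = Suc CARD('T)"
    using card_image[OF inj] by simp
  ultimately have "xtime ` (UNIV :: 'T option set) = {..CARD('T)}"
    by (intro card_subset_eq) auto
  with inj show ?thesis by (simp add: bij_betw_def)
qed

definition stack :: "('t::finite \<Rightarrow> real^'k) \<Rightarrow> real^('t \<times> 'k)" where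
  "stack v = (\<chi> i. v (fst i) $ snd i)"

definition stack2 :: "real^'a \<Rightarrow> real^'b \<Rightarrow> real^('a + 'b)" where
  "stack2 v v' = (\<chi> i. case i of Inl a \<Rightarrow> v $ a | Inr b \<Rightarrow> v' $ b)"

definition mstack2 :: "real^'c^'a \<Rightarrow> real^'c^'b \<Rightarrow> real^'c^('a + 'b)" where
  "mstack2 X Y = (\<chi> i. case i of Inl a \<Rightarrow> X $ a | Inr b \<Rightarrow> Y $ b)"

(* Multiplication in the type class for vectors is componentwise, so ^ is not the matrix power. *)
definition mpow :: "real^'n^'n \<Rightarrow> nat \<Rightarrow> real^'n^'n" where
  "mpow A k = (((**) A) ^^ k) (mat 1)"

definition Abar :: "real^'n^'n \<Rightarrow> real^'n^('T::{finite,linorder} option \<times> 'n)" where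
  "Abar A = (\<chi> i j. mpow A (xtime (fst i)) $ snd i $ j)"

definition Bbar :: "real^'n^'n \<Rightarrow> real^'m^'n
    \<Rightarrow> real^('T::{finite,linorder} \<times> 'm)^('T option \<times> 'n)" where
  "Bbar A B = (\<chi> i j. if time (fst j) < xtime (fst i)
     then (mpow A (xtime (fst i) - 1 - time (fst j)) ** B) $ snd i $ snd j else 0)"

definition Dbar :: "real^'n^'n \<Rightarrow> real^('T::{finite,linorder} \<times> 'n)^('T option \<times> 'n)" where
  "Dbar A = (\<chi> i j. if time (fst j) < xtime (fst i)
     then mpow A (xtime (fst i) - 1 - time (fst j)) $ snd i $ snd j else 0)"

lemma mpow_0 [simp]: "mpow A 0 = mat 1"
  by (simp add: mpow_def)

lemma mpow_Suc [simp]: "mpow A (Suc k) = A ** mpow A k"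
  by (simp add: mpow_def)

type_synonym ('T, 'n, 'm) policy = "(real^('T \<times> 'n)^('T \<times> 'm)) \<times> (real^('T \<times> 'm))"

definition Theta :: "('T::{finite,linorder}, 'n::finite, 'm::finite) policy set" where
  "Theta = {(G, d). \<forall>t i r c. time t \<le> time i \<longrightarrow> G $ (t, r) $ (i, c) = 0}"

definition input :: "('T::{finite,linorder}, 'n::finite, 'm::finite) policy
    \<Rightarrow> real^('T \<times> 'n) \<Rightarrow> real^('T \<times> 'm)" where
  "input \<theta> wbar = fst \<theta> *v wbar + snd \<theta>"

definition state :: "real^'n^'n \<Rightarrow> real^'m^'n \<Rightarrow> real^'n
    \<Rightarrow> ('T::{finite,linorder}, 'n::finite, 'm::finite) policy
    \<Rightarrow> real^('T \<times> 'n) \<Rightarrow> real^('T option \<times> 'n)" where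
  "state A B x0 \<theta> wbar = Abar A *v x0 + Bbar A B *v (fst \<theta> *v wbar + snd \<theta>) + Dbar A *v wbar"

text \<open>The stacked formula does describe the trajectory of the linear system.\<close>

lemma matrix_vector_mult_sum: "A *v (\<Sum>i\<in>I. f i) = (\<Sum>i\<in>I. (A :: real^'n^'m) *v f i)"
  by (induction I rule: infinite_finite_induct) (simp_all add: matrix_vector_right_distrib)

lemma state_block:
  "(\<chi> k. state A B x0 \<theta> wbar $ (r, k)) = mpow A (xtime r) *v x0 +
     (\<Sum>s | time s < xtime r. mpow A (xtime r - 1 - time s) *v
        (B *v (\<chi> k. input \<theta> wbar $ (s, k)) + (\<chi> k. wbar $ (s, k))))"
proof -
  have *: "(\<Sum>j\<in>UNIV. (if time (fst j) < m then F j else 0) * v $ j)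
      = (\<Sum>s | time s < m. \<Sum>k\<in>UNIV. F (s, k) * v $ (s, k))"
    for m and F :: "'t::{finite,linorder} \<times> 'k::finite \<Rightarrow> real" and v :: "real^('t \<times> 'k)"
  proof -
    have "(\<Sum>j\<in>UNIV. (if time (fst j) < m then F j else 0) * v $ j)
        = (\<Sum>s\<in>UNIV. \<Sum>k\<in>UNIV. (if time s < m then F (s, k) else 0) * v $ (s, k))"
      by (simp add: UNIV_Times_UNIV [symmetric] sum.cartesian_product case_prod_beta
          del: UNIV_Times_UNIV) (auto intro!: sum.cong)
    also have "\<dots> = (\<Sum>s\<in>UNIV. if time s < m then \<Sum>k\<in>UNIV. F (s, k) * v $ (s, k) else 0)"
      by (rule sum.cong) auto
    also have "\<dots> = (\<Sum>s | time s < m. \<Sum>k\<in>UNIV. F (s, k) * v $ (s, k))"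
      by (simp add: sum.If_cases)
    finally show ?thesis .
  qed
  let ?m = "\<lambda>s. mpow A (xtime r - 1 - time s)"
  have A: "(Abar A *v x0) $ (r, i) = (mpow A (xtime r) *v x0) $ i" for i
    by (simp add: Abar_def matrix_vector_mult_def)
  have B: "(Bbar A B *v u) $ (r, i)
      = (\<Sum>s | time s < xtime r. (?m s *v (B *v (\<chi> k. u $ (s, k)))) $ i)" for u i
    unfolding matrix_vector_mul_assoc by (simp add: Bbar_def matrix_vector_mult_def *)
  have D: "(Dbar A *v wbar) $ (r, i)
      = (\<Sum>s | time s < xtime r. (?m s *v (\<chi> k. wbar $ (s, k))) $ i)" for i
    by (simp add: Dbar_def matrix_vector_mult_def *)
  show ?thesis
    unfolding state_def input_def [symmetric]
    by (simp add: vec_eq_iff A B D matrix_vector_right_distrib sum.distrib)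
qed

lemma state_0: "state A B x0 \<theta> wbar $ (None, i) = x0 $ i"
  using arg_cong [OF state_block [of A B x0 \<theta> wbar None], of "\<lambda>v. v $ i"] by simp

lemma state_Suc:
  fixes s :: "'T::{finite,linorder}"
  assumes "xtime r = time s"
  shows "(\<chi> k. state A B x0 \<theta> wbar $ (Some s, k)) = A *v (\<chi> k. state A B x0 \<theta> wbar $ (r, k)) +
     B *v (\<chi> k. input \<theta> wbar $ (s, k)) + (\<chi> k. wbar $ (s, k))"
proof -
  let ?v = "\<lambda>s :: 'T. B *v (\<chi> k. input \<theta> wbar $ (s, k)) + (\<chi> k. wbar $ (s, k))"
  have "{s'. time s' < Suc (time s)} = insert s {s'. time s' < time s}"
    using bij_betw_time [where 'T='T] by (auto simp: less_Suc_eq bij_betw_def inj_def)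
  then have "(\<Sum>s' | time s' < Suc (time s). mpow A (time s - time s') *v ?v s')
      = ?v s + (\<Sum>s' | time s' < time s. mpow A (time s - time s') *v ?v s')"
    by simp
  also have "(\<Sum>s' | time s' < time s. mpow A (time s - time s') *v ?v s')
      = A *v (\<Sum>s' | time s' < time s. mpow A (time s - 1 - time s') *v ?v s')"
    unfolding matrix_vector_mult_sum
  proof (rule sum.cong [OF refl])
    fix s' :: 'T assume "s' \<in> {s'. time s' < time s}"
    then have "time s - time s' = Suc (time s - 1 - time s')" by auto
    then show "mpow A (time s - time s') *v ?v s' = A *v (mpow A (time s - 1 - time s') *v ?v s')"
      by (simp add: matrix_vector_mul_assoc)
  qed
  finally show ?thesis
    unfolding state_block using assms
    by (simp add: matrix_vector_right_distrib matrix_vector_mul_assoc algebra_simps)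
qed

definition h_vec :: "real^'n^'n \<Rightarrow> real^'m^'n \<Rightarrow> real^'n
    \<Rightarrow> real^(('T::{finite,linorder} option \<times> 'n) + ('T \<times> 'm))
    \<Rightarrow> ('T, 'n::finite, 'm::finite) policy \<Rightarrow> real^(('T option \<times> 'n) + ('T \<times> 'm))" where
  "h_vec A B x0 \<delta> \<theta> = stack2 (Abar A *v x0 + Bbar A B *v snd \<theta>) (snd \<theta>) - \<delta>"

definition P_mat :: "real^'n^'n \<Rightarrow> real^'m^'n
    \<Rightarrow> ('T::{finite,linorder}, 'n::finite, 'm::finite) policy
    \<Rightarrow> real^('T \<times> 'n)^(('T option \<times> 'n) + ('T \<times> 'm))" where
  "P_mat A B \<theta> = mstack2 (Bbar A B ** fst \<theta> + Dbar A) (fst \<theta>)"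

definition eta :: "real^('a + 'b)^('a + 'b) \<Rightarrow> real^('a + 'b)
    \<Rightarrow> real^'a \<Rightarrow> real^'b \<Rightarrow> real" where
  "eta \<Xi> \<delta> x u = (stack2 x u - \<delta>) \<bullet> (\<Xi> *v (stack2 x u - \<delta>)) - 1"

definition pos_semidef :: "real^'k^'k \<Rightarrow> bool" where
  "pos_semidef X \<longleftrightarrow> transpose X = X \<and> (\<forall>v. 0 \<le> v \<bullet> (X *v v))"

definition pos_def :: "real^'k^'k \<Rightarrow> bool" where
  "pos_def X \<longleftrightarrow> transpose X = X \<and> (\<forall>v. v \<noteq> 0 \<longrightarrow> 0 < v \<bullet> (X *v v))"

definition psd_sqrt :: "real^'k^'k \<Rightarrow> real^'k^'k" where
  "psd_sqrt X = (THE R. pos_semidef R \<and> R ** R = X)"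

definition mvn_density :: "real^'k \<Rightarrow> real^'k^'k \<Rightarrow> real^'k \<Rightarrow> real" where
  "mvn_density \<mu> \<Sigma> x =
     exp (- ((x - \<mu>) \<bullet> (matrix_inv \<Sigma> *v (x - \<mu>))) / 2) / sqrt ((2 * pi) ^ CARD('k) * det \<Sigma>)"

(* The law of the sum of the squares of k independent standard normal variables. *)
definition chi_square :: "nat \<Rightarrow> real measure" where
  "chi_square k = distr (\<Pi>\<^sub>M i\<in>{..<k}. std_normal_distribution) borel (\<lambda>z. \<Sum>i<k. (z i)\<^sup>2)"

(* The distribution function vanishes on the negative half-line and, for k > 0, is a bijection
   from [0, \<infinity>) onto [0, 1); it is inverted there. *)
definition beta :: "nat \<Rightarrow> real \<Rightarrow> real" where
  "beta k \<alpha> = sqrt (inv_into {0..} (cdf (chi_square k)) (1 - \<alpha>))"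

definition S_mat :: "real^'n^'n \<Rightarrow> real^'m^'n \<Rightarrow> real^('T \<times> 'n)^('T \<times> 'n)
    \<Rightarrow> real^(('T option \<times> 'n) + ('T \<times> 'm))^(('T option \<times> 'n) + ('T \<times> 'm)) \<Rightarrow> real
    \<Rightarrow> ('T::{finite,linorder}, 'n::finite, 'm::finite) policy
    \<Rightarrow> real^('T \<times> 'n)^(('T option \<times> 'n) + ('T \<times> 'm))" where
  "S_mat A B \<Sigma> \<Xi> \<alpha> \<theta> = beta (CARD('T) * CARD('n)) \<alpha> *\<^sub>R (psd_sqrt \<Xi> ** P_mat A B \<theta> ** psd_sqrt \<Sigma>)"

definition xi_vec :: "real^'n^'n \<Rightarrow> real^'m^'n \<Rightarrow> real^'n
    \<Rightarrow> real^(('T option \<times> 'n) + ('T \<times> 'm))^(('T option \<times> 'n) + ('T \<times> 'm))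
    \<Rightarrow> real^(('T option \<times> 'n) + ('T \<times> 'm))
    \<Rightarrow> ('T::{finite,linorder}, 'n::finite, 'm::finite) policy
    \<Rightarrow> real^(('T option \<times> 'n) + ('T \<times> 'm))" where
  "xi_vec A B x0 \<Xi> \<delta> \<theta> = psd_sqrt \<Xi> *v h_vec A B x0 \<delta> \<theta>"

definition block_matrix :: "real \<Rightarrow> real^'q \<Rightarrow> real^'p^'q \<Rightarrow> real^(unit + 'p + 'q)^(unit + 'p + 'q)" where
  "block_matrix l x Y = (\<chi> i j.
     case i of
       Inl _ \<Rightarrow>
         (case j of Inl _ \<Rightarrow> - l + 1 | Inr (Inl _) \<Rightarrow> 0 | Inr (Inr q) \<Rightarrow> x $ q)
     | Inr (Inl p) \<Rightarrow>
         (case j of Inl _ \<Rightarrow> 0 | Inr (Inl p') \<Rightarrow> (l *\<^sub>R mat 1 :: real^'p^'p) $ p $ p'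
                  | Inr (Inr q) \<Rightarrow> transpose Y $ p $ q)
     | Inr (Inr q) \<Rightarrow>
         (case j of Inl _ \<Rightarrow> x $ q | Inr (Inl p) \<Rightarrow> Y $ q $ p
                  | Inr (Inr q') \<Rightarrow> (mat 1 :: real^'q^'q) $ q $ q'))"

(* The semidefiniteness constraint F p \<ge> 0 in the unknown p ranging over the linear space U
   is a linear matrix inequality. *)
definition is_LMI :: "'p::real_vector set \<Rightarrow> ('p \<Rightarrow> real^'k^'k) \<Rightarrow> bool" where
  "is_LMI U F \<longleftrightarrow> subspace U \<and> (\<forall>p\<in>U. transpose (F p) = F p) \<and>
     (\<exists>F0 L. linear L \<and> (\<forall>p\<in>U. F p = F0 + L p))"

(* Both problems minimize J over \<Theta>: the original one subject to C \<theta>, the approximating one,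
   which has the additional real unknown \<lambda>, subject to C' \<theta> \<lambda>. *)
definition convex_conservative_approximation ::
    "'p::real_vector set \<Rightarrow> ('p \<Rightarrow> real) \<Rightarrow> ('p \<Rightarrow> real \<Rightarrow> bool) \<Rightarrow> ('p \<Rightarrow> bool) \<Rightarrow> bool" where
  "convex_conservative_approximation \<Theta> J C' C \<longleftrightarrow>
     convex_on (\<Theta> \<times> UNIV) (\<lambda>(\<theta>, l :: real). J \<theta>) \<and>
     convex {(\<theta>, l). \<theta> \<in> \<Theta> \<and> C' \<theta> l} \<and>
     (\<forall>\<theta> l. \<theta> \<in> \<Theta> \<and> C' \<theta> l \<longrightarrow> C \<theta>)"

end

theory Submission
  imports Defs
begin

text \<open>
  The chance constraint is implied by a robust one. A centred Gaussian vector \<open>w\<close> lies in the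
  confidence ellipsoid \<open>w \<bullet> (matrix_inv \<Sigma> *v w) \<le> \<beta>\<^sup>2\<close> with probability exactly \<open>1 - \<alpha>\<close>, because the
  quadratic form on the left has the chi-square law (\<open>mvn_ellipsoid_probability\<close>) and \<open>\<beta>\<^sup>2\<close> is its
  quantile (\<open>cdf_chi_square_beta\<close>). It is enough that \<open>\<eta> \<le> 0\<close> on the whole ellipsoid. Its points
  are \<open>\<beta> \<Sigma>\<^sup>1\<^sup>/\<^sup>2 z\<close> with \<open>|z| \<le> 1\<close>, and there \<open>\<eta> \<le> 0\<close> says that \<open>|\<xi> + S z| \<le> 1\<close>
  (\<open>eta_nonpos_on_ellipsoid\<close>). The LMI gives this bound when its form is evaluated at
  \<open>(1, z, - (\<xi> + S z))\<close> (\<open>block_matrix_pos_semidef_imp\<close>).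

  The chi-square law of the form comes from scaling alone. For a continuous function \<open>q\<close>, positive off 0,
  that is homogeneous of degree 2, the volume of \<open>{x. q x \<le> r}\<close>, \<open>r > 0\<close>, is a multiple of \<open>sqrt r ^ DIM('a)\<close>.
  Therefore two densities that are multiples of \<open>exp (- q x / 2)\<close> and of \<open>exp (- (x \<bullet> x) / 2)\<close> give
  \<open>q x\<close> and \<open>x \<bullet> x\<close> the same law, up to a constant that the total mass 1 fixes
  (\<open>gauge_law_unique\<close>).

  The matrices \<open>\<xi>\<close>, \<open>S\<close> and the block matrix depend affinely on the unknowns, so the
  constraint is an LMI and its solutions form a convex set; the pair of state and input is affine in
  the policy as well, so the expected cost is convex (\<open>convex_expectation\<close>). All of this presupposes
  that the square roots of \<open>\<Xi>\<close> and \<open>\<Sigma>\<close> exist and are unique, which the spectral theorem for symmetric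
  matrices provides (\<open>psd_sqrt\<close>).
\<close>

section \<open>Square roots of positive semidefinite matrices\<close>

lemma transpose_eq_self_iff:
  fixes X :: "real^'k^'k"
  shows "transpose X = X \<longleftrightarrow> (\<forall>x y. x \<bullet> (X *v y) = y \<bullet> (X *v x))"
proof -
  have *: "y \<bullet> (transpose X *v x) = x \<bullet> (X *v y)" for x y
    by (metis dot_lmul_matrix inner_commute transpose_matrix_vector)
  show ?thesis
  proof
    assume "transpose X = X"
    then show "\<forall>x y. x \<bullet> (X *v y) = y \<bullet> (X *v x)"
      using * by metis
  next
    assume sym: "\<forall>x y. x \<bullet> (X *v y) = y \<bullet> (X *v x)"
    have "transpose X *v x = X *v x" for x
      using vector_eq_ldot[of "transpose X *v x" "X *v x"] * sym by metis
    then show "transpose X = X"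
      by (simp add: matrix_eq)
  qed
qed

lemma pos_semidef_sym: "pos_semidef X \<Longrightarrow> x \<bullet> (X *v y) = y \<bullet> (X *v x)"
  using transpose_eq_self_iff unfolding pos_semidef_def by blast

text \<open>
  A maximizer of the Rayleigh quotient over the unit sphere of an invariant subspace is an
  eigenvector. The maximality of the eigenvalue is kept in the conclusion because uniqueness of
  square roots rests on it.
\<close>

lemma symmetric_max_eigenvector:
  fixes X :: "real^'k^'k"
  assumes sym: "transpose X = X" and sub: "subspace S" and inv: "\<And>x. x \<in> S \<Longrightarrow> X *v x \<in> S"
    and ne: "S \<noteq> {0}"
  obtains v \<mu> where "v \<in> S" "norm v = 1" "X *v v = \<mu> *\<^sub>R v"
    "\<And>x. x \<in> S \<Longrightarrow> x \<bullet> (X *v x) \<le> \<mu> * (x \<bullet> x)"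
proof -
  have s: "x \<bullet> (X *v y) = y \<bullet> (X *v x)" for x y
    using sym transpose_eq_self_iff by blast
  let ?K = "sphere 0 1 \<inter> S"
  have "compact ?K"
    using sub by (intro compact_Int_closed closed_subspace) auto
  moreover have "?K \<noteq> {}"
  proof -
    obtain x where "x \<in> S" "x \<noteq> 0"
      using ne subspace_0[OF sub] by blast
    then have "(1 / norm x) *\<^sub>R x \<in> ?K"
      using sub by (simp add: subspace_scale)
    then show ?thesis by blast
  qed
  moreover have "continuous_on ?K (\<lambda>x. x \<bullet> (X *v x))"
    by (intro continuous_on_inner continuous_on_id matrix_vector_mult_linear_continuous_on)
  ultimately obtain v where v: "v \<in> ?K" and max: "\<And>x. x \<in> ?K \<Longrightarrow> x \<bullet> (X *v x) \<le> v \<bullet> (X *v v)"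
    using continuous_attains_sup[of ?K "\<lambda>x. x \<bullet> (X *v x)"]
    by metis
  define \<mu> where "\<mu> = v \<bullet> (X *v v)"
  have bound: "x \<bullet> (X *v x) \<le> \<mu> * (x \<bullet> x)" if "x \<in> S" for x
  proof (cases "x = 0")
    case False
    then have "(1 / norm x) *\<^sub>R x \<in> ?K"
      using sub that by (simp add: subspace_scale)
    from max[OF this] False show ?thesis
      by (simp add: \<mu>_def matrix_vector_mult_scaleR field_simps power2_norm_eq_inner[symmetric] power2_eq_square)
  qed simp
  have nv: "v \<bullet> v = 1" "v \<in> S"
    using v by (auto simp: norm_eq_1)
  (* \<open>\<mu> |x|\<^sup>2 - x \<bullet> X x\<close> is minimal at \<open>v\<close>, so its derivative in the direction \<open>y\<close> vanishes. *)
  define y where "y = \<mu> *\<^sub>R v - X *v v"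
  have "y \<in> S"
    unfolding y_def by (intro subspace_diff sub subspace_scale nv inv)
  define b where "b = \<mu> * (y \<bullet> y) - y \<bullet> (X *v y)"
  have "0 \<le> 2 * t * (y \<bullet> y) + t\<^sup>2 * b" for t
  proof -
    have "v + t *\<^sub>R y \<in> S"
      by (intro subspace_add sub subspace_scale nv \<open>y \<in> S\<close>)
    from bound[OF this]
    have "v \<bullet> (X *v v) + 2 * t * (y \<bullet> (X *v v)) + t\<^sup>2 * (y \<bullet> (X *v y))
        \<le> \<mu> * (v \<bullet> v) + 2 * t * (y \<bullet> (\<mu> *\<^sub>R v)) + t\<^sup>2 * (\<mu> * (y \<bullet> y))"
      by (simp add: s[of v y] inner_commute[of v y] matrix_vector_mult_scaleR matrix_vector_right_distrib inner_add_left
          inner_add_right power2_eq_square algebra_simps)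
    moreover have "y \<bullet> (\<mu> *\<^sub>R v) = y \<bullet> (X *v v) + y \<bullet> y"
      by (subst (4) y_def) (simp add: inner_diff_right)
    ultimately show ?thesis
      unfolding nv(1) \<mu>_def[symmetric] b_def by (simp del: inner_scaleR_right add: algebra_simps)
  qed
  (* The parabola in \<open>t\<close> is nonnegative with slope \<open>2 (y \<bullet> y)\<close> at 0; this \<open>t\<close> makes it negative
     unless \<open>y = 0\<close>, whatever the sign of \<open>b\<close>. *)
  from this[of "- (y \<bullet> y) / (\<bar>b\<bar> + 1)"]
  have "0 \<le> - 2 * (y \<bullet> y)\<^sup>2 / (\<bar>b\<bar> + 1) + (y \<bullet> y)\<^sup>2 / (\<bar>b\<bar> + 1) * (b / (\<bar>b\<bar> + 1))"
    by (simp add: power2_eq_square algebra_simps)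
  also have "\<dots> \<le> - 2 * (y \<bullet> y)\<^sup>2 / (\<bar>b\<bar> + 1) + (y \<bullet> y)\<^sup>2 / (\<bar>b\<bar> + 1) * 1"
    by (intro add_left_mono mult_left_mono) auto
  finally have "(y \<bullet> y)\<^sup>2 / (\<bar>b\<bar> + 1) \<le> 0" by simp
  then have "y = 0"
    using abs_ge_zero[of b] by (auto simp: divide_le_0_iff simp del: abs_ge_zero)
  then show ?thesis
    using nv bound by (intro that[of v \<mu>]) (auto simp: y_def norm_eq_1)
qed

text \<open>
  An orthonormal set of eigenvectors of maximal cardinality must span: its orthogonal complement
  is invariant by symmetry and, if it were nontrivial, would contain one more eigenvector.
\<close>

lemma symmetric_orthonormal_eigenbasis:
  fixes X :: "real^'k^'k"
  assumes sym: "transpose X = X"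
  obtains E \<mu> where "finite E" "\<And>b. b \<in> E \<Longrightarrow> norm b = 1" "pairwise orthogonal E"
    "\<And>b. b \<in> E \<Longrightarrow> X *v b = \<mu> b *\<^sub>R b" "\<And>x. x = (\<Sum>b\<in>E. (b \<bullet> x) *\<^sub>R b)"
proof -
  have s: "x \<bullet> (X *v y) = y \<bullet> (X *v x)" for x y
    using sym transpose_eq_self_iff by blast
  define P where "P E \<longleftrightarrow> finite E \<and> (\<forall>b\<in>E. norm b = 1) \<and> pairwise orthogonal E
      \<and> (\<forall>b\<in>E. \<exists>\<mu>. X *v b = \<mu> *\<^sub>R b)" for E :: "(real^'k) set"
  have "P {}" by (simp add: P_def)
  moreover have "card E < Suc DIM(real^'k)" if "P E" for E
  proof -
    have "independent E"
      using that by (intro pairwise_orthogonal_independent) (auto simp: P_def)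
    then show ?thesis
      using independent_card_le[of E] by simp
  qed
  ultimately obtain E where E: "P E" and max: "\<And>E'. P E' \<Longrightarrow> card E' \<le> card E"
    using ex_has_greatest_nat[of P "{}" card "Suc DIM(real^'k)"] by auto
  define S where "S = {x. \<forall>b\<in>E. b \<bullet> x = 0}"
  have sub: "subspace S"
    by (auto simp: S_def subspace_def inner_add_right)
  have inv: "X *v x \<in> S" if "x \<in> S" for x
  proof -
    have "b \<bullet> (X *v x) = 0" if b: "b \<in> E" for b
    proof -
      obtain \<mu> where "X *v b = \<mu> *\<^sub>R b"
        using E b by (auto simp: P_def)
      then show ?thesis
        using \<open>x \<in> S\<close> b by (simp add: s[of b x] S_def inner_commute)
    qed
    then show ?thesis by (simp add: S_def)
  qed
  have "S = {0}"
  proof (rule ccontr)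
    assume "S \<noteq> {0}"
    then obtain v \<mu> where v: "v \<in> S" "norm v = 1" "X *v v = \<mu> *\<^sub>R v"
      using symmetric_max_eigenvector[OF sym sub inv] by metis
    have "v \<notin> E"
      using v by (auto simp: S_def)
    moreover have "P (insert v E)"
      using E v by (auto simp: P_def S_def pairwise_insert orthogonal_def inner_commute)
    ultimately show False
      using max[of "insert v E"] E by (simp add: P_def)
  qed
  have "x = (\<Sum>b\<in>E. (b \<bullet> x) *\<^sub>R b)" for x
  proof -
    have "b \<bullet> (x - (\<Sum>c\<in>E. (c \<bullet> x) *\<^sub>R c)) = 0" if b: "b \<in> E" for b
    proof -
      have "b \<bullet> (\<Sum>c\<in>E. (c \<bullet> x) *\<^sub>R c) = (\<Sum>c\<in>E. if c = b then b \<bullet> x else 0)"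
        unfolding inner_sum_right
        using E b by (intro sum.cong) (auto simp: P_def pairwise_def orthogonal_def norm_eq_1)
      then show ?thesis
        using E b by (simp add: P_def inner_diff_right)
    qed
    then have "x - (\<Sum>c\<in>E. (c \<bullet> x) *\<^sub>R c) \<in> S" by (simp add: S_def)
    then show ?thesis using \<open>S = {0}\<close> by simp
  qed
  moreover obtain \<mu> where "\<And>b. b \<in> E \<Longrightarrow> X *v b = \<mu> b *\<^sub>R b"
    using E unfolding P_def by metis
  ultimately show ?thesis
    using E by (intro that[of E \<mu>]) (auto simp: P_def)
qed

lemma pos_semidef_sqrt_exists:
  fixes X :: "real^'k^'k"
  assumes "pos_semidef X"
  obtains R where "pos_semidef R" "R ** R = X"
proof -
  have sym: "transpose X = X" and nonneg: "\<And>v. 0 \<le> v \<bullet> (X *v v)"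
    using assms by (auto simp: pos_semidef_def)
  obtain E \<mu> where E: "finite E" "\<And>b. b \<in> E \<Longrightarrow> norm b = 1" "pairwise orthogonal E"
    "\<And>b. b \<in> E \<Longrightarrow> X *v b = \<mu> b *\<^sub>R b" "\<And>x. x = (\<Sum>b\<in>E. (b \<bullet> x) *\<^sub>R b)"
    using symmetric_orthonormal_eigenbasis[OF sym] by blast
  have \<mu>: "0 \<le> \<mu> b" if "b \<in> E" for b
    using nonneg[of b] E(2,4)[OF that] by (simp add: norm_eq_1)
  define r where "r x = (\<Sum>b\<in>E. (sqrt (\<mu> b) * (b \<bullet> x)) *\<^sub>R b)" for x
  have lin: "linear r"
    unfolding r_def
    by (rule linearI) (simp_all add: algebra_simps inner_add_right sum.distrib scaleR_sum_right)
  have r: "matrix r *v x = r x" for x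
    using matrix_works[of r] lin by (simp add: linear_matrix_vector_mul_eq)
  have eq: "x \<bullet> r y = (\<Sum>b\<in>E. sqrt (\<mu> b) * ((b \<bullet> x) * (b \<bullet> y)))" for x y
    by (simp add: r_def inner_sum_right inner_commute algebra_simps)
  have "pos_semidef (matrix r)"
  proof -
    have "x \<bullet> r y = y \<bullet> r x" for x y
      unfolding eq by (rule sum.cong) (simp_all add: mult.commute)
    moreover have "0 \<le> x \<bullet> r x" for x
      unfolding eq using \<mu> by (intro sum_nonneg) simp
    ultimately show ?thesis
      unfolding pos_semidef_def transpose_eq_self_iff r by blast
  qed
  moreover have rb: "r b = sqrt (\<mu> b) *\<^sub>R b" if b: "b \<in> E" for b
  proof -
    have "r b = (\<Sum>c\<in>E. if c = b then sqrt (\<mu> b) *\<^sub>R b else 0)"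
      unfolding r_def
      using E b by (intro sum.cong) (auto simp: pairwise_def orthogonal_def norm_eq_1)
    then show ?thesis using E(1) b by simp
  qed
  have "(matrix r ** matrix r) *v x = X *v x" for x
  proof -
    have "r (r x) = (\<Sum>b\<in>E. (sqrt (\<mu> b) * (b \<bullet> x)) *\<^sub>R r b)"
      by (subst (2) r_def) (simp add: linear_sum[OF lin] linear_scale[OF lin])
    also have "\<dots> = (\<Sum>b\<in>E. (b \<bullet> x) *\<^sub>R (X *v b))"
      using \<mu> by (intro sum.cong refl) (simp add: rb E(4) mult.assoc mult.left_commute)
    also have "\<dots> = X *v (\<Sum>b\<in>E. (b \<bullet> x) *\<^sub>R b)"
      by (simp add: linear_sum[of "(*v) X"] matrix_vector_mult_scaleR)
    finally show ?thesis
      using E(5)[of x] by (simp add: matrix_vector_mul_assoc[symmetric] r)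
  qed
  then have "matrix r ** matrix r = X"
    by (simp add: matrix_eq)
  ultimately show ?thesis by (rule that)
qed

text \<open>
  Exchanging \<open>R\<close> and \<open>S\<close> turns this into uniqueness of the square root. If \<open>\<mu>\<close> is the largest
  eigenvalue of \<open>R - S\<close>, with unit eigenvector \<open>v\<close>, then
  \<open>0 = |R v|\<^sup>2 - |S v|\<^sup>2 = \<mu> (v \<bullet> R v + v \<bullet> S v)\<close>. So either \<open>\<mu> = 0\<close>, or both of the nonnegative
  numbers \<open>v \<bullet> R v\<close> and \<open>v \<bullet> S v\<close> vanish, and then so does their difference, which is \<open>\<mu>\<close>.
\<close>

lemma pos_semidef_sqrt_form_le:
  fixes R S :: "real^'k^'k"
  assumes R: "pos_semidef R" and S: "pos_semidef S" and eq: "R ** R = S ** S"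
  shows "x \<bullet> ((R - S) *v x) \<le> 0"
proof -
  have symR: "\<And>x y. x \<bullet> (R *v y) = y \<bullet> (R *v x)" and symS: "\<And>x y. x \<bullet> (S *v y) = y \<bullet> (S *v x)"
    using R S by (blast intro: pos_semidef_sym)+
  have "transpose (R - S) = R - S"
    unfolding transpose_eq_self_iff
    by (simp add: inner_diff_right matrix_vector_mult_diff_rdistrib symR[of _ _] symS[of _ _])
  moreover have "(UNIV :: (real^'k) set) \<noteq> {0}"
    using UNIV_not_singleton by blast
  ultimately obtain v \<mu> where v: "norm v = 1" "(R - S) *v v = \<mu> *\<^sub>R v"
    and max: "\<And>x. x \<bullet> ((R - S) *v x) \<le> \<mu> * (x \<bullet> x)"
    using symmetric_max_eigenvector[of "R - S" UNIV] by auto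
  have \<mu>: "R *v v = S *v v + \<mu> *\<^sub>R v"
    using v(2) by (simp add: matrix_vector_mult_diff_rdistrib algebra_simps)
  have nn: "0 \<le> v \<bullet> (R *v v)" "0 \<le> v \<bullet> (S *v v)"
    using R S by (auto simp: pos_semidef_def)
  have "(R *v v) \<bullet> (R *v v) = (S *v v) \<bullet> (S *v v)"
    using symR[of "R *v v" v] symS[of "S *v v" v] eq by (simp add: matrix_vector_mul_assoc)
  then have "\<mu> * (v \<bullet> (R *v v) + v \<bullet> (S *v v)) = 0"
    by (simp add: \<mu> inner_add_left inner_add_right inner_commute algebra_simps)
  moreover have "v \<bullet> (R *v v) - v \<bullet> (S *v v) = \<mu>"
    using v(1) by (simp add: \<mu> inner_add_right norm_eq_1)
  ultimately have "\<mu> = 0"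
    using nn by auto
  then show ?thesis using max[of x] by simp
qed

lemma pos_semidef_sqrt_unique:
  fixes R S :: "real^'k^'k"
  assumes R: "pos_semidef R" and S: "pos_semidef S" and eq: "R ** R = S ** S"
  shows "R = S"
proof -
  have le: "x \<bullet> ((R - S) *v x) = 0" for x
    using pos_semidef_sqrt_form_le[OF R S eq, of x] pos_semidef_sqrt_form_le[OF S R eq[symmetric], of x]
    by (simp add: matrix_vector_mult_diff_rdistrib inner_diff_right)
  have sym: "x \<bullet> ((R - S) *v y) = y \<bullet> ((R - S) *v x)" for x y
  proof -
    have "x \<bullet> (R *v y) = y \<bullet> (R *v x)" "x \<bullet> (S *v y) = y \<bullet> (S *v x)"
      using R S by (blast intro: pos_semidef_sym)+
    then show ?thesis by (simp add: matrix_vector_mult_diff_rdistrib inner_diff_right)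
  qed
  have "x \<bullet> ((R - S) *v y) = 0" for x y
    using le[of "x + y"] le[of x] le[of y] sym[of x y]
    by (simp add: matrix_vector_right_distrib inner_add_left inner_add_right)
  then have "(R - S) *v y = 0" for y
    by (metis inner_eq_zero_iff)
  then show ?thesis
    by (simp add: matrix_eq matrix_vector_mult_diff_rdistrib)
qed

lemma psd_sqrt:
  assumes "pos_semidef X"
  shows "pos_semidef (psd_sqrt X)" "psd_sqrt X ** psd_sqrt X = X"
proof -
  obtain R where "pos_semidef R \<and> R ** R = X"
    using pos_semidef_sqrt_exists[OF assms] by metis
  then have "pos_semidef (psd_sqrt X) \<and> psd_sqrt X ** psd_sqrt X = X"
    unfolding psd_sqrt_def
    by (rule theI[where P = "\<lambda>R. pos_semidef R \<and> R ** R = X"]) (metis \<open>pos_semidef R \<and> R ** R = X\<close> pos_semidef_sqrt_unique)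
  then show "pos_semidef (psd_sqrt X)" "psd_sqrt X ** psd_sqrt X = X" by auto
qed

section \<open>Volumes of sublevel sets of quadratic gauges\<close>

lemma emeasure_lborel_scaleR_image:
  fixes S :: "'a::euclidean_space set"
  assumes S: "S \<in> sets borel" and c: "0 < c"
  shows "emeasure lborel ((*\<^sub>R) c ` S) = ennreal (c ^ DIM('a)) * emeasure lborel S"
proof -
  have eq: "(*\<^sub>R) c ` S = (\<lambda>x. 0 + (1 / c) *\<^sub>R x) -` S"
  proof (intro set_eqI iffI)
    fix x assume "x \<in> (\<lambda>x. 0 + (1 / c) *\<^sub>R x) -` S"
    then show "x \<in> (*\<^sub>R) c ` S"
      using c by (intro image_eqI[of _ _ "(1 / c) *\<^sub>R x"]) auto
  qed (use c in auto)
  have T: "(\<lambda>x. 0 + (1 / c) *\<^sub>R x) \<in> borel_measurable (lborel :: 'a measure)" by simp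
  have "emeasure lborel S = (\<integral>\<^sup>+ x. ennreal (\<bar>1 / c\<bar> ^ DIM('a)) * indicator S x
      \<partial>distr lborel borel (\<lambda>x. 0 + (1 / c) *\<^sub>R x))"
    using S c by (subst lborel_affine[of "1/c" 0]) (simp_all add: emeasure_density)
  also have "\<dots> = ennreal (1 / c ^ DIM('a)) * emeasure lborel ((*\<^sub>R) c ` S)"
    using S c T by (subst nn_integral_cmult) (simp_all add: emeasure_distr eq power_divide)
  finally have "ennreal (c ^ DIM('a)) * emeasure lborel S
      = ennreal (c ^ DIM('a)) * ennreal (1 / c ^ DIM('a)) * emeasure lborel ((*\<^sub>R) c ` S)"
    by (simp add: mult.assoc)
  then show ?thesis
    using c by (simp flip: ennreal_mult')
qed

text \<open>
  These are the properties of a positive definite quadratic form that govern the volumes of its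
  sublevel sets: homogeneity relates any two of them by scaling, and continuity and positivity
  make the volume of the unit one positive and finite.
\<close>

locale quadratic_gauge =
  fixes q :: "'a::euclidean_space \<Rightarrow> real"
  assumes continuous: "continuous_on UNIV q"
    and scaleR: "\<And>c x. q (c *\<^sub>R x) = c\<^sup>2 * q x"
    and pos: "\<And>x. x \<noteq> 0 \<Longrightarrow> 0 < q x"
begin

lemma zero: "q 0 = 0"
  using scaleR[of 0 0] by simp

lemma nonneg: "0 \<le> q x"
  using pos[of x] zero by (cases "x = 0") auto

lemma borel_measurable [measurable]: "q \<in> borel_measurable borel"
  using continuous by (rule borel_measurable_continuous_onI)

lemma sublevel_borel: "{x. q x \<le> r} \<in> sets borel"
  by measurable

lemma emeasure_sublevel:
  assumes "0 < r"
  shows "emeasure lborel {x. q x \<le> r} = ennreal (sqrt r ^ DIM('a)) * emeasure lborel {x. q x \<le> 1}"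
proof -
  have "{x. q x \<le> r} = (*\<^sub>R) (sqrt r) ` {x. q x \<le> 1}"
  proof (intro set_eqI iffI)
    fix x assume "x \<in> {x. q x \<le> r}"
    then show "x \<in> (*\<^sub>R) (sqrt r) ` {x. q x \<le> 1}"
      using assms by (intro image_eqI[of _ _ "(1 / sqrt r) *\<^sub>R x"]) (auto simp: scaleR power_divide)
  qed (use assms in \<open>auto simp: scaleR mult_left_le\<close>)
  then show ?thesis
    using assms emeasure_lborel_scaleR_image[OF sublevel_borel, of "sqrt r" 1] by simp
qed

lemma sublevel_bounded: "bounded {x. q x \<le> 1}"
proof -
  obtain b where b: "b \<in> Basis" using SOME_Basis by blast
  have "sphere (0::'a) 1 \<noteq> {}" using b by (auto simp: norm_Basis)
  then obtain y where y: "norm y = 1" "\<And>x. norm x = 1 \<Longrightarrow> q y \<le> q x"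
    using continuous_attains_inf[of "sphere 0 1" q] continuous_on_subset[OF continuous]
    by auto
  have qy: "0 < q y" using y(1) by (intro pos) auto
  have "norm x \<le> 1 / sqrt (q y)" if "q x \<le> 1" for x
  proof (cases "x = 0")
    case False
    then have "q y \<le> q ((1 / norm x) *\<^sub>R x)" by (intro y) simp
    also have "\<dots> = q x / (norm x)\<^sup>2" by (simp add: scaleR power_divide)
    finally have "q y * (norm x)\<^sup>2 \<le> 1"
      using False that by (simp add: field_simps)
    then have "sqrt (q y * (norm x)\<^sup>2) \<le> 1" by (simp only: real_sqrt_le_1_iff)
    then show ?thesis using qy by (simp add: real_sqrt_mult field_simps)
  qed (use qy in simp)
  then show ?thesis by (auto intro: boundedI)
qed

lemma emeasure_unit_sublevel: "0 < emeasure lborel {x. q x \<le> 1}" "emeasure lborel {x. q x \<le> 1} < \<infinity>"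
proof -
  show "emeasure lborel {x. q x \<le> 1} < \<infinity>"
    using sublevel_bounded by (rule emeasure_bounded_finite)
  have "open {x. q x < 1}"
    using continuous by (intro open_Collect_less) auto
  moreover have "0 \<in> {x. q x < 1}" by (simp add: zero)
  ultimately obtain e where e: "0 < e" "ball 0 e \<subseteq> {x. q x < 1}"
    unfolding open_contains_ball by blast
  have "0 < emeasure lborel (ball (0::'a) e)"
    using e(1) by (simp add: emeasure_ball unit_ball_vol_pos less_imp_le zero_less_power ennreal_zero_less_mult_iff flip: ennreal_mult')
  also have "\<dots> \<le> emeasure lborel {x. q x \<le> 1}"
    using e(2) sublevel_borel by (intro emeasure_mono) auto
  finally show "0 < emeasure lborel {x. q x \<le> 1}" .
qed

lemma emeasure_sublevel_finite: "emeasure lborel {x. q x \<le> r} < \<infinity>"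
proof -
  have "emeasure lborel {x. q x \<le> r} \<le> emeasure lborel {x. q x \<le> max r 1}"
    by (intro emeasure_mono) (auto intro: sublevel_borel)
  also have "\<dots> < \<infinity>"
    using emeasure_sublevel[of "max r 1"] emeasure_unit_sublevel(2)
    by (simp add: ennreal_mult_less_top)
  finally show ?thesis .
qed

end

text \<open>
  By homogeneity the volume of the sublevel set at \<open>r > 0\<close> is \<open>sqrt r ^ DIM('a)\<close> times the volume of
  the unit one, for every gauge. So the image measures on the line agree up to the ratio of the two
  unit volumes, which is finite and nonzero.
\<close>

lemma quadratic_gauges_proportional:
  fixes q q' :: "'a::euclidean_space \<Rightarrow> real"
  assumes "quadratic_gauge q" "quadratic_gauge q'"
  obtains k where "distr lborel borel q = scale_measure k (distr lborel borel q')"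
proof -
  interpret q: quadratic_gauge q by fact
  interpret q': quadratic_gauge q' by fact
  let ?v = "emeasure lborel {x. q x \<le> 1}" and ?v' = "emeasure lborel {x. q' x \<le> 1}"
  define k where "k = ?v / ?v'"
  have k: "?v = k * ?v'"
    using q'.emeasure_unit_sublevel by (simp add: k_def ennreal_divide_times ennreal_times_divide mult_divide_eq_ennreal)
  have sub: "emeasure (distr lborel borel p) {..r} = emeasure lborel {x. p x \<le> r}"
    if "quadratic_gauge p" for p :: "'a \<Rightarrow> real" and r
    using quadratic_gauge.borel_measurable[OF that] by (simp add: emeasure_distr vimage_def)
  have le: "emeasure lborel {x. q x \<le> r} = k * emeasure lborel {x. q' x \<le> r}" for r
  proof -
    consider "r < 0" | "r = 0" | "0 < r" by linarith
    then show ?thesis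
    proof cases
      case 1
      then have "\<not> q x \<le> r" "\<not> q' x \<le> r" for x
        using q.nonneg[of x] q'.nonneg[of x] by linarith+
      then show ?thesis by simp
    next
      case 2
      have "q x \<le> r \<longleftrightarrow> x = 0" "q' x \<le> r \<longleftrightarrow> x = 0" for x
        using q.pos[of x] q'.pos[of x] q.zero q'.zero 2 by (cases "x = 0"; simp)+
      then show ?thesis by simp
    next
      case 3
      then show ?thesis
        unfolding q.emeasure_sublevel[OF 3] q'.emeasure_sublevel[OF 3] k by (simp add: ac_simps)
    qed
  qed
  have "distr lborel borel q = scale_measure k (distr lborel borel q')"
  proof (rule measure_eqI_generator_eq[where E = "range (\<lambda>r::real. {..r})" and A = "\<lambda>n. {..real n}" and \<Omega> = UNIV])
    show "Int_stable (range (\<lambda>r::real. {..r}))"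
      by (auto simp: Int_stable_def)
    show "emeasure (distr lborel borel q) X = emeasure (scale_measure k (distr lborel borel q')) X"
      if "X \<in> range (\<lambda>r::real. {..r})" for X
      using that by (auto simp: sub assms le emeasure_scale_measure)
    show "(\<Union>n. {..real n}) = UNIV"
      using real_arch_simple by auto
    show "emeasure (distr lborel borel q) {..real n} \<noteq> \<infinity>" for n
      using q.emeasure_sublevel_finite[of "real n"] by (simp add: sub assms)
  qed (auto simp: borel_eq_atMost)
  then show ?thesis by (rule that)
qed

text \<open>
  A density \<open>C * g (q x)\<close> determines the law of \<open>q\<close>, independently of the gauge \<open>q\<close>: the constant
  of proportionality between the two image measures is absorbed by the normalizations \<open>C\<close> and
  \<open>C'\<close>, whatever their values are. For the Gaussian densities below, this identifies the law of the
  quadratic form from the total mass, with the determinant in the density left as an opaque factor.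
\<close>

lemma gauge_law_unique:
  fixes q q' :: "'a::euclidean_space \<Rightarrow> real" and g :: "real \<Rightarrow> real"
  assumes q: "quadratic_gauge q" and q': "quadratic_gauge q'"
    and g [measurable]: "g \<in> borel_measurable borel"
    and one: "(\<integral>\<^sup>+x. ennreal (C * g (q x)) \<partial>lborel) = 1" "(\<integral>\<^sup>+x. ennreal (C' * g (q' x)) \<partial>lborel) = 1"
    and C: "0 \<le> C" "0 \<le> C'" and A [measurable]: "A \<in> sets borel"
  shows "(\<integral>\<^sup>+x. ennreal (C * g (q x)) * indicator A (q x) \<partial>lborel)
       = (\<integral>\<^sup>+x. ennreal (C' * g (q' x)) * indicator A (q' x) \<partial>lborel)"
proof -
  have [measurable]: "q \<in> borel_measurable borel" "q' \<in> borel_measurable borel"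
    using q q' by (simp_all add: quadratic_gauge.borel_measurable)
  obtain k where k: "distr lborel borel q = scale_measure k (distr lborel borel q')"
    using quadratic_gauges_proportional[OF q q'] .
  have int: "(\<integral>\<^sup>+x. f (q x) \<partial>lborel) = k * (\<integral>\<^sup>+x. f (q' x) \<partial>lborel)"
    if [measurable]: "f \<in> borel_measurable borel" for f :: "real \<Rightarrow> ennreal"
  proof -
    have "(\<integral>\<^sup>+x. f (q x) \<partial>lborel) = (\<integral>\<^sup>+y. f y \<partial>distr lborel borel q)"
      by (simp add: nn_integral_distr)
    then show ?thesis
      by (simp add: k nn_integral_distr nn_integral_scale_measure)
  qed
  let ?G = "\<integral>\<^sup>+x. ennreal (g (q' x)) \<partial>lborel"
  have out: "(\<integral>\<^sup>+x. ennreal (D * g (p x)) * indicator B (p x) \<partial>lborel)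
      = ennreal D * (\<integral>\<^sup>+x. ennreal (g (p x)) * indicator B (p x) \<partial>lborel)"
    if "0 \<le> D" and [measurable]: "p \<in> borel_measurable borel" "B \<in> sets borel" for D and p :: "'a \<Rightarrow> real" and B
    using that(1) by (subst nn_integral_cmult[symmetric]) (auto simp: ennreal_mult' mult.assoc)
  have "ennreal C * k * ?G = 1" "ennreal C' * ?G = 1"
    using one out[of C q UNIV] out[of C' q' UNIV] int[of "\<lambda>s. ennreal (g s)"] C
    by (simp_all add: mult.assoc)
  then have "ennreal C * k = ennreal C'"
    by (metis mult.commute mult.left_commute mult_1)
  then show ?thesis
    using int[of "\<lambda>s. ennreal (g s) * indicator A s"] C
    by (simp add: out mult.assoc[symmetric])
qed

section \<open>The chi-square law as the law of a squared norm\<close>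

lemma PiM_density:
  fixes f :: "'a::euclidean_space \<Rightarrow> ennreal"
  assumes I: "finite I" and f [measurable]: "f \<in> borel_measurable lborel"
    and sf: "sigma_finite_measure (density lborel f)"
  shows "(\<Pi>\<^sub>M i\<in>I. density lborel f) = density (\<Pi>\<^sub>M i\<in>I. lborel) (\<lambda>x. \<Prod>i\<in>I. f (x i))"
proof (rule sym)
  interpret P: product_sigma_finite "\<lambda>i. density lborel f"
    using sf by (simp add: product_sigma_finite_def)
  interpret L: product_sigma_finite "\<lambda>i. lborel :: 'a measure"
    by (simp add: product_sigma_finite_def lborel.sigma_finite_measure_axioms)
  show "density (\<Pi>\<^sub>M i\<in>I. lborel) (\<lambda>x. \<Prod>i\<in>I. f (x i)) = (\<Pi>\<^sub>M i\<in>I. density lborel f)"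
  proof (rule P.PiM_eqI[OF I])
    show "sets (density (\<Pi>\<^sub>M i\<in>I. lborel) (\<lambda>x. \<Prod>i\<in>I. f (x i))) = sets (\<Pi>\<^sub>M i\<in>I. density lborel f)"
      by (simp cong: sets_PiM_cong)
    fix A assume "\<And>i. i \<in> I \<Longrightarrow> A i \<in> sets (density lborel f)"
    then have A: "A i \<in> sets lborel" if "i \<in> I" for i
      using that by simp
    have "emeasure (density (\<Pi>\<^sub>M i\<in>I. lborel) (\<lambda>x. \<Prod>i\<in>I. f (x i))) (Pi\<^sub>E I A)
        = (\<integral>\<^sup>+x. (\<Prod>i\<in>I. f (x i)) * indicator (Pi\<^sub>E I A) x \<partial>(\<Pi>\<^sub>M i\<in>I. lborel))"
      using A I by (intro emeasure_density) (auto intro!: sets_PiM_I_finite)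
    also have "\<dots> = (\<integral>\<^sup>+x. (\<Prod>i\<in>I. f (x i) * indicator (A i) (x i)) \<partial>(\<Pi>\<^sub>M i\<in>I. lborel))"
    proof (rule nn_integral_cong)
      fix x assume "x \<in> space (\<Pi>\<^sub>M i\<in>I. lborel :: 'a measure)"
      then have "indicator (Pi\<^sub>E I A) x = (\<Prod>i\<in>I. indicator (A i) (x i) :: ennreal)"
        using I by (auto simp: space_PiM PiE_iff indicator_def prod_zero_iff)
      then show "(\<Prod>i\<in>I. f (x i)) * indicator (Pi\<^sub>E I A) x = (\<Prod>i\<in>I. f (x i) * indicator (A i) (x i))"
        by (simp add: prod.distrib)
    qed
    also have "\<dots> = (\<Prod>i\<in>I. \<integral>\<^sup>+x. f x * indicator (A i) x \<partial>lborel)"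
      using A by (intro L.product_nn_integral_prod I) auto
    also have "\<dots> = (\<Prod>i\<in>I. emeasure (density lborel f) (A i))"
      using A by (intro prod.cong) (auto simp: emeasure_density)
    finally show "emeasure (density (\<Pi>\<^sub>M i\<in>I. lborel) (\<lambda>x. \<Prod>i\<in>I. f (x i))) (Pi\<^sub>E I A)
        = (\<Prod>i\<in>I. emeasure (density lborel f) (A i))" .
  qed
qed

definition std_mvn_density :: "'a::euclidean_space \<Rightarrow> real" where
  "std_mvn_density x = exp (- (x \<bullet> x) / 2) / sqrt ((2 * pi) ^ DIM('a))"

lemma std_mvn_density_measurable [measurable]: "std_mvn_density \<in> borel_measurable borel"
  unfolding std_mvn_density_def by measurable

lemma std_mvn_density_eq_prod:
  fixes x :: "'a::euclidean_space"
  shows "std_mvn_density x = (\<Prod>b\<in>Basis. std_normal_density (x \<bullet> b))"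
proof -
  have "(\<Prod>b\<in>Basis. std_normal_density (x \<bullet> b))
      = exp (\<Sum>b\<in>(Basis::'a set). - (x \<bullet> b)\<^sup>2 / 2) / sqrt (2 * pi) ^ DIM('a)"
    by (simp add: std_normal_density_def prod.distrib prod_dividef exp_sum power_divide)
  also have "(\<Sum>b\<in>(Basis::'a set). - (x \<bullet> b)\<^sup>2 / 2) = - (x \<bullet> x) / 2"
    by (subst (2) euclidean_inner) (simp add: sum_negf sum_divide_distrib power2_eq_square)
  finally show ?thesis
    unfolding std_mvn_density_def real_sqrt_power by simp
qed

lemma density_std_mvn_density:
  "density lborel (\<lambda>x. ennreal (std_mvn_density x))
    = distr (\<Pi>\<^sub>M b\<in>(Basis :: 'a::euclidean_space set). std_normal_distribution) borel (\<lambda>f. \<Sum>b\<in>Basis. f b *\<^sub>R b)"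
proof -
  have [measurable]: "(\<lambda>f. \<Sum>b\<in>Basis. f b *\<^sub>R b) \<in> borel_measurable (\<Pi>\<^sub>M b\<in>(Basis :: 'a set). lborel :: real measure)"
    by measurable
  have "density lborel (\<lambda>x::'a. ennreal (std_mvn_density x))
      = distr (density (\<Pi>\<^sub>M b\<in>(Basis :: 'a set). lborel)
          (\<lambda>f. ennreal (std_mvn_density (\<Sum>b\<in>Basis. f b *\<^sub>R b)))) borel (\<lambda>f. \<Sum>b\<in>Basis. f b *\<^sub>R b)"
    by (subst lborel_eq, subst density_distr) simp_all
  also have "(\<lambda>f. ennreal (std_mvn_density (\<Sum>b\<in>(Basis::'a set). f b *\<^sub>R b)))
      = (\<lambda>f. \<Prod>b\<in>Basis. ennreal (std_normal_density (f b)))"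
    by (simp add: std_mvn_density_eq_prod prod_ennreal)
  finally show ?thesis
    by (subst PiM_density)
      (simp_all add: prob_space_imp_sigma_finite prob_space_normal_density)
qed

text \<open>
  The coordinates of a standard normal vector are independent standard normal variables, and
  the sum of their squares is the square of the norm. It remains to renumber the coordinates.
\<close>

lemma chi_square_eq_distr:
  "chi_square DIM('a::euclidean_space)
    = distr (density lborel (\<lambda>x::'a. ennreal (std_mvn_density x))) borel (\<lambda>x. x \<bullet> x)"
proof -
  let ?N = "std_normal_distribution"
  obtain e where e: "bij_betw e {..<DIM('a)} (Basis :: 'a set)"
    using ex_bij_betw_nat_finite[of "Basis :: 'a set"] by (auto simp: atLeast0LessThan)
  then have eB: "e i \<in> Basis" if "i < DIM('a)" for i
    using that by (auto simp: bij_betw_def)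
  have "(\<Pi>\<^sub>M i\<in>{..<DIM('a)}. ?N)
      = distr (\<Pi>\<^sub>M b\<in>(Basis :: 'a set). ?N) (\<Pi>\<^sub>M i\<in>{..<DIM('a)}. ?N) (\<lambda>f. \<lambda>i\<in>{..<DIM('a)}. f (e i))"
    using e by (intro distr_PiM_reindex[symmetric]) (auto simp: bij_betw_def prob_space_normal_density)
  then have "chi_square DIM('a) = distr (distr (\<Pi>\<^sub>M b\<in>(Basis :: 'a set). ?N) (\<Pi>\<^sub>M i\<in>{..<DIM('a)}. ?N)
      (\<lambda>f. \<lambda>i\<in>{..<DIM('a)}. f (e i))) borel (\<lambda>z. \<Sum>i<DIM('a). (z i)\<^sup>2)"
    by (simp add: chi_square_def)
  also have "\<dots> = distr (\<Pi>\<^sub>M b\<in>(Basis :: 'a set). ?N) borel (\<lambda>f. \<Sum>i<DIM('a). (f (e i))\<^sup>2)"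
    using eB by (subst distr_distr) (auto simp: comp_def intro!: measurable_restrict)
  also have "(\<lambda>f. \<Sum>i<DIM('a). (f (e i))\<^sup>2) = (\<lambda>f. \<Sum>b\<in>(Basis :: 'a set). (f b)\<^sup>2)"
    by (intro ext sum.reindex_bij_betw e)
  also have "\<dots> = (\<lambda>x. x \<bullet> x) \<circ> (\<lambda>f. \<Sum>b\<in>(Basis :: 'a set). f b *\<^sub>R b)"
    by (rule ext, subst comp_apply, subst euclidean_inner) (simp add: power2_eq_square)
  also have "distr (\<Pi>\<^sub>M b\<in>(Basis :: 'a set). ?N) borel \<dots> = distr (density lborel (\<lambda>x::'a. ennreal (std_mvn_density x))) borel (\<lambda>x. x \<bullet> x)"
    unfolding density_std_mvn_density by (subst distr_distr) simp_all
  finally show ?thesis .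
qed

lemma real_distribution_chi_square: "real_distribution (chi_square k)"
proof -
  interpret prob_space "\<Pi>\<^sub>M i\<in>{..<k}. std_normal_distribution"
    by (intro prob_space_PiM prob_space_normal_density) simp
  show ?thesis
    unfolding chi_square_def by (intro real_distribution_distr) simp
qed

lemma emeasure_chi_square:
  assumes [measurable]: "A \<in> sets borel"
  shows "emeasure (chi_square DIM('a::euclidean_space)) A
    = (\<integral>\<^sup>+x. ennreal (std_mvn_density x) * indicator A (x \<bullet> x) \<partial>(lborel :: 'a measure))"
proof -
  have "emeasure (chi_square DIM('a)) A = emeasure (density lborel (\<lambda>x::'a. ennreal (std_mvn_density x))) ((\<lambda>x. x \<bullet> x) -` A)"
    unfolding chi_square_eq_distr by (subst emeasure_distr) auto
  also have "\<dots> = (\<integral>\<^sup>+x. ennreal (std_mvn_density x) * indicator ((\<lambda>x. x \<bullet> x) -` A) x \<partial>(lborel :: 'a measure))"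
  proof (rule emeasure_density)
    have "(\<lambda>x::'a. x \<bullet> x) -` A \<inter> space borel \<in> sets borel"
      by (rule measurable_sets[OF _ assms]) simp
    then show "(\<lambda>x::'a. x \<bullet> x) -` A \<in> sets lborel" by simp
  qed simp
  finally show ?thesis by (simp add: indicator_def)
qed

text \<open>
  Spheres are null sets, so the distribution function is continuous and takes the value
  \<open>1 - \<alpha>\<close>, necessarily at a nonnegative argument. This is what makes the inverse in the definition
  of \<^const>\<open>beta\<close> meaningful.
\<close>

lemma cdf_chi_square_beta:
  assumes "0 < \<alpha>" "\<alpha> < 1"
  shows "cdf (chi_square DIM('a::euclidean_space)) ((beta DIM('a) \<alpha>)\<^sup>2) = 1 - \<alpha>"
proof -
  let ?F = "cdf (chi_square DIM('a))"
  interpret real_distribution "chi_square DIM('a)" by (rule real_distribution_chi_square)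
  have neg: "?F s = 0" if "s < 0" for s
  proof -
    have "\<not> x \<bullet> x \<le> s" for x :: 'a
      using that inner_ge_zero[of x] by linarith
    then have "indicator {..s} (x \<bullet> x) = (0 :: ennreal)" for x :: 'a
      by (simp add: indicator_def)
    then show ?thesis
      by (simp add: cdf_def2 measure_def emeasure_chi_square)
  qed
  have "isCont ?F s" for s
  proof -
    have "{x::'a. x \<bullet> x = s} \<subseteq> sphere 0 (sqrt s)"
      by (auto simp: norm_eq_sqrt_inner)
    then have "{x::'a. x \<bullet> x = s} \<in> null_sets lborel"
      using negligible_subset[OF negligible_sphere] null_sets_completion_iff[of "{x::'a. x \<bullet> x = s}" lborel]
      unfolding negligible_iff_null_sets by auto
    then have "AE x in lborel. x \<bullet> (x::'a) \<noteq> s"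
      by (simp add: AE_iff_null)
    then have "AE x in lborel. ennreal (std_mvn_density (x::'a)) * indicator {s} (x \<bullet> x) = 0"
      by eventually_elim simp
    then have "emeasure (chi_square DIM('a)) {s} = (\<integral>\<^sup>+x. 0 \<partial>(lborel :: 'a measure))"
      by (subst emeasure_chi_square, simp) (rule nn_integral_cong_AE)
    then show ?thesis
      by (simp add: isCont_cdf measure_def)
  qed
  moreover obtain b where b: "0 \<le> b" "1 - \<alpha> \<le> ?F b"
  proof -
    have "eventually (\<lambda>x. 1 - \<alpha> < ?F x) at_top"
      using cdf_lim_at_top_prob assms by (intro order_tendstoD) auto
    then have "eventually (\<lambda>x. 1 - \<alpha> < ?F x \<and> 0 \<le> x) at_top"
      using eventually_ge_at_top[of 0] by eventually_elim auto
    then show ?thesis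
      using that by (auto dest!: eventually_happens simp: less_imp_le)
  qed
  ultimately obtain s where s: "?F s = 1 - \<alpha>"
    using IVT[of ?F "-1" "1 - \<alpha>" b] neg[of "-1"] assms by auto
  then have "0 \<le> s"
    using neg[of s] assms by force
  then have "1 - \<alpha> \<in> ?F ` {0..}"
    using s by force
  from f_inv_into_f[OF this] inv_into_into[OF this] show ?thesis
    by (simp add: beta_def)
qed

section \<open>Confidence ellipsoids of a Gaussian vector\<close>

lemma pos_def_imp_pos_semidef: "pos_def X \<Longrightarrow> pos_semidef X"
  unfolding pos_def_def pos_semidef_def
proof (elim conjE, intro conjI allI)
  fix v assume "\<forall>v. v \<noteq> 0 \<longrightarrow> 0 < v \<bullet> (X *v v)"
  then show "0 \<le> v \<bullet> (X *v v)"
    by (cases "v = 0") (auto intro: less_imp_le)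
qed

lemma pos_def_matrix_inv:
  fixes X :: "real^'k^'k"
  assumes "pos_def X"
  shows "X *v (matrix_inv X *v x) = x"
proof -
  have "invertible X"
    unfolding invertible_left_inverse matrix_left_invertible_ker
  proof (intro allI impI)
    fix v assume "X *v v = 0"
    then have "\<not> 0 < v \<bullet> (X *v v)" by simp
    then show "v = 0" using assms unfolding pos_def_def by blast
  qed
  then have "X ** matrix_inv X = mat 1"
    using someI_ex[of "\<lambda>Y. X ** Y = mat 1 \<and> Y ** X = mat 1"] by (simp add: invertible_def matrix_inv_def)
  then show ?thesis
    by (simp add: matrix_vector_mul_assoc)
qed

lemma quadratic_gauge_matrix_inv:
  assumes "pos_def X"
  shows "quadratic_gauge (\<lambda>x. x \<bullet> (matrix_inv X *v x))"
proof
  show "continuous_on UNIV (\<lambda>x. x \<bullet> (matrix_inv X *v x))"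
    by (intro continuous_on_inner continuous_on_id matrix_vector_mult_linear_continuous_on)
  show "(c *\<^sub>R x) \<bullet> (matrix_inv X *v (c *\<^sub>R x)) = c\<^sup>2 * (x \<bullet> (matrix_inv X *v x))" for c x
    by (simp add: matrix_vector_mult_scaleR power2_eq_square mult.assoc)
  show "0 < x \<bullet> (matrix_inv X *v x)" if "x \<noteq> 0" for x
  proof -
    let ?y = "matrix_inv X *v x"
    have "X *v ?y = x" by (rule pos_def_matrix_inv[OF assms])
    moreover have "?y \<noteq> 0" using calculation that by (metis matrix_vector_mult_0_right)
    ultimately show ?thesis
      using assms unfolding pos_def_def by (metis inner_commute)
  qed
qed

lemma quadratic_gauge_inner: "quadratic_gauge (\<lambda>x. x \<bullet> x)"
proof
  show "continuous_on UNIV (\<lambda>x::'a. x \<bullet> x)"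
    by (intro continuous_on_inner continuous_on_id)
qed (simp_all add: power2_eq_square mult.assoc)

text \<open>
  Both \<open>x \<bullet> (matrix_inv \<Sigma> *v x)\<close> and \<open>x \<bullet> x\<close> are quadratic gauges, and both Gaussian densities are
  multiples of the same function \<open>exp (- s / 2)\<close> of the gauge. Hence the gauges have the same law.
\<close>

lemma (in prob_space) mvn_ellipsoid_probability:
  fixes X :: "'a \<Rightarrow> real^'k"
  assumes \<Sigma>: "pos_def \<Sigma>" and X: "distributed M lborel X (mvn_density 0 \<Sigma>)"
  shows "prob {\<omega> \<in> space M. X \<omega> \<bullet> (matrix_inv \<Sigma> *v X \<omega>) \<le> r} = cdf (chi_square CARD('k)) r"
proof -
  let ?q = "\<lambda>x. x \<bullet> (matrix_inv \<Sigma> *v x)"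
  define C C' where "C = 1 / sqrt ((2 * pi) ^ CARD('k) * det \<Sigma>)" and "C' = 1 / sqrt ((2 * pi) ^ CARD('k))"
  have dens: "mvn_density 0 \<Sigma> x = C * exp (- ?q x / 2)"
    "std_mvn_density x = C' * exp (- (x \<bullet> x) / 2)" for x
    by (simp_all add: mvn_density_def std_mvn_density_def C_def C'_def)
  interpret chi: real_distribution "chi_square CARD('k)" by (rule real_distribution_chi_square)
  have one: "(\<integral>\<^sup>+x. ennreal (C * exp (- ?q x / 2)) \<partial>lborel) = 1"
    using distributed_emeasure[OF X, of UNIV] emeasure_space_1 by (simp add: dens)
  have one': "(\<integral>\<^sup>+x. ennreal (C' * exp (- (x \<bullet> x) / 2)) \<partial>(lborel :: (real^'k) measure)) = 1"
    using emeasure_chi_square[of UNIV, where 'a = "real^'k"] chi.emeasure_space_1 by (simp add: dens)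
  (* A negative constant would make the density, hence the total mass, vanish. *)
  have C: "0 \<le> C"
  proof (rule ccontr)
    assume "\<not> 0 \<le> C"
    then have "ennreal (C * exp (- ?q x / 2)) = 0" for x
      by (intro ennreal_neg) (simp add: mult_nonpos_nonneg)
    then show False using one by simp
  qed
  have [measurable]: "?q \<in> borel_measurable borel"
    by (rule quadratic_gauge.borel_measurable[OF quadratic_gauge_matrix_inv[OF \<Sigma>]])
  have "emeasure M {\<omega> \<in> space M. ?q (X \<omega>) \<le> r} = emeasure M (X -` {x. ?q x \<le> r} \<inter> space M)"
    by (intro arg_cong[where f = "emeasure M"]) auto
  also have "\<dots> = (\<integral>\<^sup>+x. ennreal (C * exp (- ?q x / 2)) * indicator {..r} (?q x) \<partial>lborel)"
    by (subst distributed_emeasure[OF X]) (simp_all add: dens indicator_def)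
  also have "\<dots> = (\<integral>\<^sup>+x. ennreal (C' * exp (- (x \<bullet> x) / 2)) * indicator {..r} (x \<bullet> x) \<partial>(lborel :: (real^'k) measure))"
    by (rule gauge_law_unique[OF quadratic_gauge_matrix_inv[OF \<Sigma>] quadratic_gauge_inner, where g = "\<lambda>s. exp (- s / 2)"])
      (use one one' C in \<open>simp_all add: C'_def\<close>)
  also have "\<dots> = emeasure (chi_square CARD('k)) {..r}"
    using emeasure_chi_square[of "{..r}", where 'a = "real^'k"] by (simp add: dens)
  finally show ?thesis
    by (simp add: measure_def cdf_def2)
qed

section \<open>The linear matrix inequality as a robust constraint\<close>

lemma block_matrix_form:
  fixes a :: real and x q :: "real^'q" and Y :: "real^'p^'q" and z :: "real^'p"
  defines "v \<equiv> (\<chi> i. case i of Inl _ \<Rightarrow> a | Inr (Inl p) \<Rightarrow> z $ p | Inr (Inr r) \<Rightarrow> q $ r) :: real^(unit + 'p + 'q)"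
  shows "v \<bullet> (block_matrix l x Y *v v)
    = (1 - l) * a\<^sup>2 + 2 * a * (x \<bullet> q) + l * (z \<bullet> z) + 2 * (q \<bullet> (Y *v z)) + q \<bullet> q"
proof -
  have split: "(\<Sum>i\<in>UNIV. f i) = f (Inl ()) + (\<Sum>p\<in>UNIV. f (Inr (Inl p))) + (\<Sum>r\<in>UNIV. f (Inr (Inr r)))"
    for f :: "unit + 'p + 'q \<Rightarrow> real"
    by (simp add: UNIV_Plus_UNIV[symmetric] sum.Plus UNIV_unit del: UNIV_Plus_UNIV)
  let ?b = "block_matrix l x Y *v v"
  have b: "?b $ Inl () = (1 - l) * a + x \<bullet> q"
    "?b $ Inr (Inl p) = l * z $ p + (transpose Y *v q) $ p"
    "?b $ Inr (Inr r) = a * x $ r + (Y *v z) $ r + q $ r" for p r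
    by (simp_all add: v_def block_matrix_def inner_vec_def matrix_vector_mult_def split mat_def
        if_distrib[of "\<lambda>c. c * _"] if_distrib[of "\<lambda>c. _ * c"] mult.assoc
        if_distribR sum.delta cong: if_cong)
  have "v \<bullet> ?b = a * ?b $ Inl () + (\<Sum>p\<in>UNIV. z $ p * ?b $ Inr (Inl p)) + (\<Sum>r\<in>UNIV. q $ r * ?b $ Inr (Inr r))"
    by (simp add: inner_vec_def split) (simp add: v_def)
  also have "\<dots> = a * ((1 - l) * a + x \<bullet> q) + z \<bullet> (l *\<^sub>R z + transpose Y *v q) + q \<bullet> (a *\<^sub>R x + Y *v z + q)"
    unfolding b by (simp add: inner_vec_def)
  also have "z \<bullet> (l *\<^sub>R z + transpose Y *v q) = l * (z \<bullet> z) + q \<bullet> (Y *v z)"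
    by (simp add: inner_add_right dot_lmul_matrix[symmetric] inner_commute)
  finally show ?thesis
    by (simp add: inner_add_right inner_commute power2_eq_square algebra_simps)
qed

lemma transpose_block_matrix: "transpose (block_matrix l x Y) = block_matrix l x Y"
  by (auto simp: vec_eq_iff transpose_def block_matrix_def mat_def split: sum.split)

lemma block_matrix_affine:
  assumes "u + v = (1::real)"
  shows "block_matrix (u * l + v * l') (u *\<^sub>R x + v *\<^sub>R x') (u *\<^sub>R Y + v *\<^sub>R Y')
    = u *\<^sub>R block_matrix l x Y + v *\<^sub>R block_matrix l' x' Y'"
  using assms by (auto simp: vec_eq_iff transpose_def block_matrix_def mat_def algebra_simps split: sum.split)

text \<open>
  Evaluate the form at the vector \<open>(1, z, - (x + Y z))\<close>, whose last block minimizes it for the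
  given first two, as in a Schur complement. The result is \<open>1 - l (1 - |z|\<^sup>2) - |x + Y z|\<^sup>2\<close>.
\<close>

lemma block_matrix_pos_semidef_imp:
  assumes psd: "pos_semidef (block_matrix l x Y)" and l: "0 \<le> l" and z: "norm z \<le> 1"
  shows "norm (x + Y *v z) \<le> 1"
proof -
  let ?y = "x + Y *v z"
  have "0 \<le> (1 - l) + 2 * (x \<bullet> (- ?y)) + l * (z \<bullet> z) + 2 * ((- ?y) \<bullet> (Y *v z)) + (- ?y) \<bullet> (- ?y)"
    using psd block_matrix_form[where a = 1 and z = z and q = "- ?y" and l = l and x = x and Y = Y]
    unfolding pos_semidef_def by (metis mult_1_right power_one)
  also have "\<dots> = 1 - l * (1 - z \<bullet> z) - ?y \<bullet> ?y"
    by (simp add: inner_add_left inner_add_right inner_commute algebra_simps)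
  finally have "?y \<bullet> ?y \<le> 1 - l * (1 - z \<bullet> z)" by simp
  also have "\<dots> \<le> 1"
    using l z by (simp add: norm_le_square power2_norm_eq_inner[symmetric] power_le_one)
  finally show ?thesis by (simp add: norm_le_square)
qed

lemma state_input_decomposition:
  "stack2 (state A B x0 \<theta> w) (input \<theta> w) - \<delta> = h_vec A B x0 \<delta> \<theta> + P_mat A B \<theta> *v w"
proof -
  have "P_mat A B \<theta> *v w = stack2 ((Bbar A B ** fst \<theta> + Dbar A) *v w) (fst \<theta> *v w)"
    by (auto simp: vec_eq_iff P_mat_def mstack2_def stack2_def matrix_vector_mult_def split: sum.split)
  also have "(Bbar A B ** fst \<theta> + Dbar A) *v w = Bbar A B *v (fst \<theta> *v w) + Dbar A *v w"
    by (simp add: matrix_vector_mult_add_rdistrib matrix_vector_mul_assoc)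
  finally show ?thesis
    by (auto simp: vec_eq_iff h_vec_def stack2_def state_def input_def matrix_vector_right_distrib split: sum.split)
qed

text \<open>
  On the confidence ellipsoid the whitened disturbance is \<open>\<beta>\<close> times a vector \<open>z'\<close> of norm at
  most 1, so that \<open>\<Xi>\<^sup>1\<^sup>/\<^sup>2\<close> applied to the deviation is \<open>\<xi> + S z'\<close>. The LMI bounds its norm by 1.
\<close>

lemma eta_nonpos_on_ellipsoid:
  fixes \<theta> :: "('T::{finite,linorder}, 'n::finite, 'm::finite) policy" and \<Sigma> :: "real^('T \<times> 'n)^('T \<times> 'n)"
  assumes \<Sigma>: "pos_def \<Sigma>" and \<Xi>: "pos_semidef \<Xi>"
    and lmi: "pos_semidef (block_matrix l (xi_vec A B x0 \<Xi> \<delta> \<theta>) (S_mat A B \<Sigma> \<Xi> \<alpha> \<theta>))" and l: "0 < l"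
    and w: "w \<bullet> (matrix_inv \<Sigma> *v w) \<le> (beta (CARD('T) * CARD('n)) \<alpha>)\<^sup>2"
  shows "eta \<Xi> \<delta> (state A B x0 \<theta> w) (input \<theta> w) \<le> 0"
proof -
  let ?R = "psd_sqrt \<Xi>" and ?Q = "psd_sqrt \<Sigma>" and ?b = "beta (CARD('T) * CARD('n)) \<alpha>"
  let ?v = "h_vec A B x0 \<delta> \<theta> + P_mat A B \<theta> *v w"
  note Q = psd_sqrt[OF pos_def_imp_pos_semidef[OF \<Sigma>]] and R = psd_sqrt[OF \<Xi>]
  note symQ = pos_semidef_sym[OF Q(1)] and symR = pos_semidef_sym[OF R(1)]
  (* \<open>z\<close> is the whitened disturbance: \<open>\<Sigma>\<^sup>-\<^sup>1\<^sup>/\<^sup>2 w\<close>. *)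
  define z where "z = ?Q *v (matrix_inv \<Sigma> *v w)"
  have Qz: "?Q *v z = w"
    unfolding z_def matrix_vector_mul_assoc[of ?Q ?Q] Q(2) by (rule pos_def_matrix_inv[OF \<Sigma>])
  have "z \<bullet> z = w \<bullet> (matrix_inv \<Sigma> *v w)"
    by (subst (2) z_def) (simp add: symQ[of z] Qz inner_commute)
  with w have "(norm z)\<^sup>2 \<le> \<bar>?b\<bar>\<^sup>2"
    by (simp add: power2_norm_eq_inner)
  then have nz: "norm z \<le> \<bar>?b\<bar>"
    by (rule power2_le_imp_le) simp
  (* If \<open>?b = 0\<close> then \<open>z = 0\<close>, and division by zero gives \<open>z' = 0\<close>, which is as good. *)
  define z' where "z' = (1 / ?b) *\<^sub>R z"
  have z: "z = ?b *\<^sub>R z'" "norm z' \<le> 1"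
    using nz by (auto simp: z'_def divide_le_eq)
  have "?R *v ?v = xi_vec A B x0 \<Xi> \<delta> \<theta> + S_mat A B \<Sigma> \<Xi> \<alpha> \<theta> *v z'"
    unfolding Qz[symmetric] z(1)
    by (simp add: xi_vec_def S_mat_def matrix_vector_right_distrib matrix_vector_mul_assoc
        matrix_vector_mult_scaleR scaleR_matrix_vector_assoc[symmetric] matrix_mul_assoc)
  then have "norm (?R *v ?v) \<le> 1"
    using block_matrix_pos_semidef_imp[OF lmi _ z(2)] l by simp
  then have "(?R *v ?v) \<bullet> (?R *v ?v) \<le> 1"
    by (simp add: norm_le_square)
  also have "(?R *v ?v) \<bullet> (?R *v ?v) = ?v \<bullet> (\<Xi> *v ?v)"
    by (subst symR) (simp add: matrix_vector_mul_assoc R(2))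
  finally show ?thesis
    unfolding eta_def state_input_decomposition by simp
qed

section \<open>Affine dependence on the unknowns and convexity\<close>

text \<open>
  The affinity condition is the one that convexity of the expected cost uses; this lemma turns it
  into the linear part that an LMI asks for. Additivity follows by taking the midpoint of
  \<open>2 x\<close> and \<open>2 y\<close>.
\<close>

lemma linear_of_affine:
  fixes f :: "'a::real_vector \<Rightarrow> 'b::real_vector"
  assumes aff: "\<And>u v x y. u + v = 1 \<Longrightarrow> f (u *\<^sub>R x + v *\<^sub>R y) = u *\<^sub>R f x + v *\<^sub>R f y"
  shows "linear (\<lambda>x. f x - f 0)"
proof (rule linearI)
  have sc: "f (c *\<^sub>R x) = c *\<^sub>R f x + (1 - c) *\<^sub>R f 0" for c x
    using aff[of c "1 - c" x 0] by simp
  show "f (x + y) - f 0 = f x - f 0 + (f y - f 0)" for x y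
  proof -
    have "f (x + y) = (1/2) *\<^sub>R f (2 *\<^sub>R x) + (1/2) *\<^sub>R f (2 *\<^sub>R y)"
      using aff[of "1/2" "1/2" "2 *\<^sub>R x" "2 *\<^sub>R y"] by simp
    also have "\<dots> = f x + f y - ((1/2) *\<^sub>R f 0 + (1/2) *\<^sub>R f 0)"
      by (simp add: sc scaleR_diff_right algebra_simps)
    also have "(1/2) *\<^sub>R f 0 + (1/2) *\<^sub>R f 0 = f 0"
      by (simp flip: scaleR_left_distrib)
    finally show ?thesis by (simp add: algebra_simps)
  qed
  show "f (c *\<^sub>R x) - f 0 = c *\<^sub>R (f x - f 0)" for c x
    by (simp add: sc algebra_simps)
qed

lemma xi_vec_affine:
  assumes "u + v = 1"
  shows "xi_vec A B x0 \<Xi> \<delta> (u *\<^sub>R \<theta> + v *\<^sub>R \<theta>') = u *\<^sub>R xi_vec A B x0 \<Xi> \<delta> \<theta> + v *\<^sub>R xi_vec A B x0 \<Xi> \<delta> \<theta>'"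
proof -
  have *: "(a::'x::real_vector) = u *\<^sub>R a + v *\<^sub>R a" for a
    using assms by (metis scaleR_left_distrib scaleR_one)
  have "stack2 (Abar A *v x0 + Bbar A B *v (u *\<^sub>R d + v *\<^sub>R d')) (u *\<^sub>R d + v *\<^sub>R d')
      = u *\<^sub>R stack2 (Abar A *v x0 + Bbar A B *v d) d + v *\<^sub>R stack2 (Abar A *v x0 + Bbar A B *v d') d'" for d d'
    by (subst *[of "Abar A *v x0"])
       (simp add: vec_eq_iff stack2_def matrix_vector_right_distrib matrix_vector_mult_scaleR algebra_simps split: sum.split)
  then have "h_vec A B x0 \<delta> (u *\<^sub>R \<theta> + v *\<^sub>R \<theta>') = u *\<^sub>R h_vec A B x0 \<delta> \<theta> + v *\<^sub>R h_vec A B x0 \<delta> \<theta>'"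
    unfolding h_vec_def by (subst (1) *[of \<delta>]) (simp add: algebra_simps)
  then show ?thesis
    unfolding xi_vec_def by (simp add: matrix_vector_right_distrib matrix_vector_mult_scaleR)
qed

lemma matrix_mul_affine_left: "X ** (u *\<^sub>R Y + v *\<^sub>R Z) = u *\<^sub>R (X ** Y) + v *\<^sub>R (X ** (Z::real^'a^'b))"
  by (simp add: vec_eq_iff matrix_matrix_mult_def sum.distrib sum_distrib_left algebra_simps)

lemma matrix_mul_affine_right: "(u *\<^sub>R Y + v *\<^sub>R Z) ** X = u *\<^sub>R (Y ** X) + v *\<^sub>R ((Z::real^'a^'b) ** X)"
  by (simp add: vec_eq_iff matrix_matrix_mult_def sum.distrib sum_distrib_left algebra_simps)

lemma S_mat_affine:
  assumes "u + v = 1"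
  shows "S_mat A B \<Sigma> \<Xi> \<alpha> (u *\<^sub>R \<theta> + v *\<^sub>R \<theta>') = u *\<^sub>R S_mat A B \<Sigma> \<Xi> \<alpha> \<theta> + v *\<^sub>R S_mat A B \<Sigma> \<Xi> \<alpha> \<theta>'"
proof -
  have *: "(a::'x::real_vector) = u *\<^sub>R a + v *\<^sub>R a" for a
    using assms by (metis scaleR_left_distrib scaleR_one)
  have "P_mat A B (u *\<^sub>R \<theta> + v *\<^sub>R \<theta>') = u *\<^sub>R P_mat A B \<theta> + v *\<^sub>R P_mat A B \<theta>'"
    unfolding P_mat_def
    by (subst *[of "Dbar A"])
       (simp add: vec_eq_iff mstack2_def matrix_mul_affine_left algebra_simps split: sum.split)
  then show ?thesis
    unfolding S_mat_def by (simp add: matrix_mul_affine_left matrix_mul_affine_right algebra_simps)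
qed

lemma subspace_Theta: "subspace Theta"
  by (auto simp: subspace_def Theta_def zero_prod_def)

lemma state_input_affine:
  assumes "u + v = 1"
  shows "(state A B x0 (u *\<^sub>R \<theta> + v *\<^sub>R \<theta>') w, input (u *\<^sub>R \<theta> + v *\<^sub>R \<theta>') w)
    = u *\<^sub>R (state A B x0 \<theta> w, input \<theta> w) + v *\<^sub>R (state A B x0 \<theta>' w, input \<theta>' w)"
proof -
  have *: "(a::'x::real_vector) = u *\<^sub>R a + v *\<^sub>R a" for a
    using assms by (metis scaleR_left_distrib scaleR_one)
  have input: "input (u *\<^sub>R \<theta> + v *\<^sub>R \<theta>') w = u *\<^sub>R input \<theta> w + v *\<^sub>R input \<theta>' w"
    by (simp add: input_def matrix_vector_mult_add_rdistrib scaleR_matrix_vector_assoc[symmetric] algebra_simps)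
  then show ?thesis
    unfolding state_def input_def[symmetric] input
    by (subst *[of "Abar A *v x0"], subst *[of "Dbar A *v w"])
       (simp add: matrix_vector_right_distrib matrix_vector_mult_scaleR algebra_simps)
qed

lemma convex_expectation:
  fixes J :: "'p::real_vector \<Rightarrow> 'o \<Rightarrow> 'y::real_vector"
  assumes V: "convex_on UNIV V" and U: "convex U"
    and aff: "\<And>u v p p' \<omega>. u + v = 1 \<Longrightarrow> J (u *\<^sub>R p + v *\<^sub>R p') \<omega> = u *\<^sub>R J p \<omega> + v *\<^sub>R J p' \<omega>"
    and int: "\<And>p. p \<in> U \<Longrightarrow> integrable M (\<lambda>\<omega>. V (J p \<omega>))"
  shows "convex_on U (\<lambda>p. \<integral>\<omega>. V (J p \<omega>) \<partial>M)"
  unfolding convex_on_def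
proof (intro conjI ballI allI impI U)
  fix p p' and u v :: real
  assume p: "p \<in> U" "p' \<in> U" and uv: "0 \<le> u" "0 \<le> v" "u + v = 1"
  have "(\<integral>\<omega>. V (J (u *\<^sub>R p + v *\<^sub>R p') \<omega>) \<partial>M) \<le> (\<integral>\<omega>. u * V (J p \<omega>) + v * V (J p' \<omega>) \<partial>M)"
  proof (rule integral_mono)
    show "integrable M (\<lambda>\<omega>. V (J (u *\<^sub>R p + v *\<^sub>R p') \<omega>))"
      using U p uv by (intro int) (simp add: convex_def)
    show "integrable M (\<lambda>\<omega>. u * V (J p \<omega>) + v * V (J p' \<omega>))"
      using int p by simp
    show "V (J (u *\<^sub>R p + v *\<^sub>R p') \<omega>) \<le> u * V (J p \<omega>) + v * V (J p' \<omega>)" for \<omega>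
      unfolding aff[OF uv(3)] using V uv by (simp add: convex_on_def)
  qed
  also have "\<dots> = u * (\<integral>\<omega>. V (J p \<omega>) \<partial>M) + v * (\<integral>\<omega>. V (J p' \<omega>) \<partial>M)"
    using int p by simp
  finally show "(\<integral>\<omega>. V (J (u *\<^sub>R p + v *\<^sub>R p') \<omega>) \<partial>M) \<le> u * (\<integral>\<omega>. V (J p \<omega>) \<partial>M) + v * (\<integral>\<omega>. V (J p' \<omega>) \<partial>M)" .
qed

lemma convex_LMI_solutions:
  assumes "is_LMI U F"
  shows "convex {p \<in> U. pos_semidef (F p)}"
proof (rule convexI)
  obtain F0 L where U: "subspace U" and sym: "\<forall>p\<in>U. transpose (F p) = F p" and L: "linear L" and F: "\<forall>p\<in>U. F p = F0 + L p"
    using assms by (auto simp: is_LMI_def)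
  fix p p' and u v :: real
  assume p: "p \<in> {p \<in> U. pos_semidef (F p)}" "p' \<in> {p \<in> U. pos_semidef (F p)}"
    and uv: "0 \<le> u" "0 \<le> v" "u + v = 1"
  let ?p = "u *\<^sub>R p + v *\<^sub>R p'"
  have "?p \<in> U" using U p by (simp add: subspace_add subspace_scale)
  have "u *\<^sub>R F0 + v *\<^sub>R F0 = F0"
    using uv by (simp flip: scaleR_left_distrib)
  moreover have "F ?p = F0 + (u *\<^sub>R L p + v *\<^sub>R L p')"
    using F \<open>?p \<in> U\<close> by (simp add: linear_add[OF L] linear_scale[OF L])
  moreover have "F p = F0 + L p" "F p' = F0 + L p'"
    using F p by auto
  ultimately have "F ?p = u *\<^sub>R F p + v *\<^sub>R F p'"
    by (metis (no_types, lifting) add.assoc add.left_commute scaleR_right_distrib)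
  then have "y \<bullet> (F ?p *v y) = u * (y \<bullet> (F p *v y)) + v * (y \<bullet> (F p' *v y))" for y
    by (simp add: matrix_vector_mult_add_rdistrib scaleR_matrix_vector_assoc[symmetric] inner_add_right)
  then have "0 \<le> y \<bullet> (F ?p *v y)" for y
    using p uv by (simp add: pos_semidef_def)
  then show "?p \<in> {p \<in> U. pos_semidef (F p)}"
    using sym \<open>?p \<in> U\<close> by (simp add: pos_semidef_def)
qed

section \<open>The convex conservative approximation\<close>

theorem proposition11:
  fixes M :: "'o measure"
    and A :: "real^'n^'n" and B :: "real^'m^'n" and x0 :: "real^'n"
    and w :: "'T::{finite,linorder} \<Rightarrow> 'o \<Rightarrow> real^'n"
    and \<Sigma> :: "real^('T \<times> 'n)^('T \<times> 'n)"
    and \<Xi> :: "real^(('T option \<times> 'n) + ('T \<times> 'm))^(('T option \<times> 'n) + ('T \<times> 'm))"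
    and \<delta> :: "real^(('T option \<times> 'n) + ('T \<times> 'm))"
    and \<alpha> :: real
  assumes "prob_space M"
    and "\<And>t. w t \<in> borel_measurable M"
    and "0 < \<alpha>" and "\<alpha> < 1"
    and "pos_def \<Sigma>"
    and "distributed M lborel (\<lambda>\<omega>. stack (\<lambda>t. w t \<omega>)) (mvn_density 0 \<Sigma>)"
    and "pos_semidef \<Xi>"
  shows
    "let \<Theta> = (Theta :: ('T, 'n, 'm) policy set);
         x = (\<lambda>\<theta> \<omega>. state A B x0 \<theta> (stack (\<lambda>t. w t \<omega>)));
         u = (\<lambda>\<theta> \<omega>. input \<theta> (stack (\<lambda>t. w t \<omega>)));
         F = (\<lambda>\<theta> l. block_matrix l (xi_vec A B x0 \<Xi> \<delta> \<theta>) (S_mat A B \<Sigma> \<Xi> \<alpha> \<theta>));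
         lmi = (\<lambda>\<theta> l. pos_semidef (F \<theta> l) \<and> l > 0);
         chance = (\<lambda>\<theta>. measure M {\<omega> \<in> space M. eta \<Xi> \<delta> (x \<theta> \<omega>) (u \<theta> \<omega>) \<le> 0} \<ge> 1 - \<alpha>)
     in is_LMI (\<Theta> \<times> (UNIV :: real set)) (\<lambda>(\<theta>, l). F \<theta> l) \<and>
        (\<forall>\<theta>\<in>\<Theta>. \<forall>l. lmi \<theta> l \<longrightarrow> chance \<theta>) \<and>
        (\<forall>V. V \<in> borel_measurable borel \<longrightarrow> convex_on UNIV V \<longrightarrow>
             (\<forall>\<theta>\<in>\<Theta>. integrable M (\<lambda>\<omega>. V (x \<theta> \<omega>, u \<theta> \<omega>))) \<longrightarrow>
             convex_conservative_approximation \<Theta>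
               (\<lambda>\<theta>. \<integral>\<omega>. V (x \<theta> \<omega>, u \<theta> \<omega>) \<partial>M) lmi chance)"
proof -
  interpret prob_space M by fact
  let ?\<Theta> = "Theta :: ('T, 'n, 'm) policy set" and ?w = "\<lambda>\<omega>. stack (\<lambda>t. w t \<omega>)"
  let ?x = "\<lambda>\<theta> \<omega>. state A B x0 \<theta> (?w \<omega>)" and ?u = "\<lambda>\<theta> \<omega>. input \<theta> (?w \<omega>)"
  let ?F = "\<lambda>(\<theta>, l). block_matrix l (xi_vec A B x0 \<Xi> \<delta> \<theta>) (S_mat A B \<Sigma> \<Xi> \<alpha> \<theta>)"
  let ?lmi = "\<lambda>\<theta> l. pos_semidef (?F (\<theta>, l)) \<and> l > 0"
  let ?chance = "\<lambda>\<theta>. measure M {\<omega> \<in> space M. eta \<Xi> \<delta> (?x \<theta> \<omega>) (?u \<theta> \<omega>) \<le> 0} \<ge> 1 - \<alpha>"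
  have w_measurable: "?w \<in> borel_measurable M"
    using assms(6) by (simp add: distributed_def)
  have LMI: "is_LMI (?\<Theta> \<times> UNIV) ?F"
  proof -
    have "?F (u *\<^sub>R p + v *\<^sub>R p') = u *\<^sub>R ?F p + v *\<^sub>R ?F p'" if "u + v = 1" for u v p p'
      using that by (simp add: case_prod_beta xi_vec_affine S_mat_affine block_matrix_affine)
    then have "linear (\<lambda>p. ?F p - ?F 0)"
      by (rule linear_of_affine)
    moreover have "?F p = ?F 0 + (?F p - ?F 0)" for p by simp
    moreover have "transpose (?F p) = ?F p" for p
      by (simp add: case_prod_beta transpose_block_matrix)
    moreover have "subspace (?\<Theta> \<times> (UNIV :: real set))"
      by (intro subspace_Times subspace_Theta subspace_UNIV)
    ultimately show ?thesis
      unfolding is_LMI_def by blast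
  qed
  have chance: "?chance \<theta>" if lmi: "?lmi \<theta> l" for \<theta> :: "('T, 'n, 'm) policy" and l
  proof -
    let ?b = "beta (CARD('T) * CARD('n)) \<alpha>"
    have "1 - \<alpha> = cdf (chi_square CARD('T \<times> 'n)) (?b\<^sup>2)"
      using cdf_chi_square_beta[OF assms(3,4), where 'a = "real^('T \<times> 'n)"] by simp
    also have "\<dots> = prob {\<omega> \<in> space M. ?w \<omega> \<bullet> (matrix_inv \<Sigma> *v ?w \<omega>) \<le> ?b\<^sup>2}"
      by (rule mvn_ellipsoid_probability[OF assms(5,6), symmetric])
    also have "\<dots> \<le> prob {\<omega> \<in> space M. eta \<Xi> \<delta> (?x \<theta> \<omega>) (?u \<theta> \<omega>) \<le> 0}"
    proof (rule finite_measure_mono)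
      show "{\<omega> \<in> space M. ?w \<omega> \<bullet> (matrix_inv \<Sigma> *v ?w \<omega>) \<le> ?b\<^sup>2}
          \<subseteq> {\<omega> \<in> space M. eta \<Xi> \<delta> (?x \<theta> \<omega>) (?u \<theta> \<omega>) \<le> 0}"
        using lmi eta_nonpos_on_ellipsoid[OF assms(5,7), of l A B x0 \<delta> \<theta> \<alpha>] by auto
      have "continuous_on UNIV (\<lambda>y. eta \<Xi> \<delta> (state A B x0 \<theta> y) (input \<theta> y))"
        unfolding eta_def state_input_decomposition matrix_vector_right_distrib matrix_vector_mul_assoc
        by (intro continuous_intros continuous_on_inner matrix_vector_mult_linear_continuous_on)
      then have "(\<lambda>\<omega>. eta \<Xi> \<delta> (?x \<theta> \<omega>) (?u \<theta> \<omega>)) \<in> borel_measurable M"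
        using measurable_compose[OF w_measurable borel_measurable_continuous_onI] by blast
      then show "{\<omega> \<in> space M. eta \<Xi> \<delta> (?x \<theta> \<omega>) (?u \<theta> \<omega>) \<le> 0} \<in> events"
        by simp
    qed
    finally show ?thesis .
  qed
  have approx: "convex_conservative_approximation ?\<Theta> (\<lambda>\<theta>. \<integral>\<omega>. V (?x \<theta> \<omega>, ?u \<theta> \<omega>) \<partial>M) ?lmi ?chance"
    if V: "convex_on UNIV V" and int: "\<forall>\<theta>\<in>?\<Theta>. integrable M (\<lambda>\<omega>. V (?x \<theta> \<omega>, ?u \<theta> \<omega>))" for V
    unfolding convex_conservative_approximation_def
  proof (intro conjI allI impI)
    have "convex_on (?\<Theta> \<times> (UNIV :: real set)) (\<lambda>p. \<integral>\<omega>. V (?x (fst p) \<omega>, ?u (fst p) \<omega>) \<partial>M)"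
    proof (rule convex_expectation[OF V, where J = "\<lambda>p \<omega>. (?x (fst p) \<omega>, ?u (fst p) \<omega>)"])
      show "convex (?\<Theta> \<times> (UNIV :: real set))"
        by (intro convex_Times subspace_imp_convex subspace_Theta convex_UNIV)
    qed (use int in \<open>auto simp: state_input_affine simp del: scaleR_Pair add_Pair\<close>)
    then show "convex_on (?\<Theta> \<times> UNIV) (\<lambda>(\<theta>, l::real). \<integral>\<omega>. V (?x \<theta> \<omega>, ?u \<theta> \<omega>) \<partial>M)"
      by (simp add: case_prod_unfold)
    have "{(\<theta>, l). \<theta> \<in> ?\<Theta> \<and> ?lmi \<theta> l} = {p \<in> ?\<Theta> \<times> UNIV. pos_semidef (?F p)} \<inter> (UNIV \<times> {0<..})"
      by auto
    then show "convex {(\<theta>, l). \<theta> \<in> ?\<Theta> \<and> ?lmi \<theta> l}"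
      using convex_LMI_solutions[OF LMI] by (simp add: convex_Int convex_Times del: mem_Times_iff)
    show "?chance \<theta>" if "\<theta> \<in> ?\<Theta> \<and> ?lmi \<theta> l" for \<theta> l
      using chance that by blast
  qed
  show ?thesis
    unfolding Let_def using LMI chance approx by simp
qed

end
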